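(* Fix $F>0$, $E\in\mathbb{R}$, $\alpha\ge0$, $\beta>0$, $\sigma\in[1/2,1]$, $C>0$, and let $h:\mathbb{N}\to\mathbb{R}$ satisfy $|h(n+1)-h(n)|\le Cn^{-\beta}$ for all integers $n\in[X_l,X_{l+1}]$. Then for all sufficiently large $l$ and all $a<b$ with $X_l+Cl^\sigma\le a<b\le X_{l+1}-Cl^\sigma$, $$\Bigl|\sum_{a<n\le b}\frac{e^{i(2\gamma(n)+h(n))}}{\gamma'(n)^\alpha}\Bigr|\lesssim l^{-\alpha-\sigma+1}\bigl(1+l^{1-2\beta}\bigr),$$ with implicit constant uniform for $E,F,\alpha,\beta,\sigma,C$ in compact subsets of their domains.
   Context: The reference solution is $\zeta(x)=(\pi/F^{1/3})^{1/2}\bigl(i\,\mathrm{Ai}(-F^{1/3}(x+E/F))+\mathrm{Bi}(-F^{1/3}(x+E/F))\bigr)$ (Airy functions); it has no real zeros and $\gamma\in C^\infty(\mathbb{R})$ is the real function with $\zeta=|\zeta|e^{i\gamma}$, $\gamma(0)\in(-\pi,\pi]$. For $l$ large, $X_l$ denotes the unique (large) solution of $\gamma'(X_l)=\pi l$; sums are over integers $n$. *)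

theory Defs
  imports "HOL-Analysis.Analysis"
begin

text \<open>Airy functions via their Maclaurin series (DLMF 9.4.1, 9.4.2).\<close>

definition airy_f :: "real \<Rightarrow> real" where
  "airy_f x = (\<Sum>k. 3 ^ k * pochhammer (1/3) k * x ^ (3*k) / fact (3*k))"

definition airy_g :: "real \<Rightarrow> real" where
  "airy_g x = (\<Sum>k. 3 ^ k * pochhammer (2/3) k * x ^ (3*k+1) / fact (3*k+1))"

definition airy_c1 :: real where
  "airy_c1 = 1 / (3 powr (2/3) * Gamma (2/3))"   \<comment> \<open>Ai(0)\<close>

definition airy_c2 :: real where
  "airy_c2 = 1 / (3 powr (1/3) * Gamma (1/3))"   \<comment> \<open>-Ai'(0)\<close>

definition airy_Ai :: "real \<Rightarrow> real" where
  "airy_Ai x = airy_c1 * airy_f x - airy_c2 * airy_g x"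

definition airy_Bi :: "real \<Rightarrow> real" where
  "airy_Bi x = sqrt 3 * (airy_c1 * airy_f x + airy_c2 * airy_g x)"

definition zeta :: "real \<Rightarrow> real \<Rightarrow> real \<Rightarrow> complex" where
  "zeta E F x = complex_of_real (sqrt (pi / F powr (1/3))) *
     (\<i> * complex_of_real (airy_Ai (- (F powr (1/3)) * (x + E / F)))
        + complex_of_real (airy_Bi (- (F powr (1/3)) * (x + E / F))))"

definition gam :: "real \<Rightarrow> real \<Rightarrow> real \<Rightarrow> real" where
  "gam E F = (THE g. continuous_on UNIV g \<and>
       (\<forall>x. zeta E F x = complex_of_real (cmod (zeta E F x)) * exp (\<i> * complex_of_real (g x))) \<and>
       - pi < g 0 \<and> g 0 \<le> pi)"

definition Xl :: "real \<Rightarrow> real \<Rightarrow> nat \<Rightarrow> real" where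
  "Xl E F l = (THE x. deriv (gam E F) x = pi * real l)"

end

theory Submission
  imports Defs
begin

text \<open>
  Everything rests on the classical formula
  \<open>Ai(-s)\<^sup>2 + Bi(-s)\<^sup>2 = 2 \<pi>\<^bsup>-3/2\<^esup> \<integral> exp (- s u\<^sup>2 - u\<^sup>6 / 12) du\<close> (integral over \<open>u > 0\<close>), which holds
  because both sides solve \<open>y''' = - 4 s y' - 2 y\<close> with the same data at \<open>0\<close> (reflection and
  duplication formulas for the Gamma function). By the Wronskian, \<open>\<gamma>' = 1 / |\<zeta>|\<^sup>2\<close>; hence \<open>\<gamma>'\<close> is
  increasing and comparable to a square root, and \<open>\<gamma>''\<close> is at least a constant over \<open>l\<close> between
  \<open>X\<^sub>l\<close> and its successor. At distance \<open>C l\<^sup>\<sigma>\<close> from these endpoints, the increments of \<open>2 \<gamma>\<close> along the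
  integers keep a distance of order \<open>l\<^sup>\<sigma> / l\<close> from the multiples of \<open>2 \<pi>\<close>, so the Kusmin--Landau
  inequality bounds the untwisted sums; partial summation puts in the weight and the slowly varying
  twist \<open>h\<close>.
\<close>

subsection \<open>The Airy equation\<close>

text \<open>The Maclaurin series that define the Airy functions do not directly show that
  \<open>zeta\<close> has no zeros, nor how it grows; the integral of a positive function gives
  both, with elementary bounds. It is the known representation of the sum of squares as pi^(-3/2)
  times the integral of t^(-1/2) exp(-s t - t^3/12) over t > 0, after t = u^2 has removed the
  singularity at 0. In the variable s = F^(1/3) (x + E/F) the phase derivative is F^(1/3) times one
  fixed function of s, so uniformity in E and F is a matter of scaling. The exponents: \<gamma>'
  grows by pi from \<open>Xl E F l\<close> to \<open>Xl E F (l + 1)\<close> at rate at least c/l, so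
  O(l) integers are summed. The gap of order l^(\<sigma>-1) costs l^(1-\<sigma>), the weight gives
  l^(-\<alpha>), and O(l) increments of h at integers n of size at least c l^2 add up to a variation
  of order l (l^2)^(-\<beta>) = l^(1-2\<beta>).\<close>

text \<open>After two termwise differentiations the recurrence makes the coefficient at
  \<open>Suc n\<close> equal to \<open>a n\<close>, and \<open>a2\<close> kills the constant term;
  what remains is x times the series. The value of y' at 0 is recorded because initial data are
  compared there later.\<close>

lemma powser_airy_ode:
  fixes a :: "nat \<Rightarrow> real"
  assumes summ: "\<And>x. summable (\<lambda>n. a n * x ^ n)"
    and a2: "a 2 = 0"
    and rec: "\<And>n. a (n + 3) * (real (n + 2) * real (n + 3)) = a n"
  shows "\<exists>y'. (\<forall>x. ((\<lambda>x. \<Sum>n. a n * x ^ n) has_real_derivative y' x) (at x)) \<and>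
              (\<forall>x. (y' has_real_derivative x * (\<Sum>n. a n * x ^ n)) (at x)) \<and> y' 0 = a 1"
proof -
  have summ': "\<And>x. summable (\<lambda>n. diffs a n * x ^ n)"
    by (rule termdiff_converges_all[OF summ])
  have dd: "diffs (diffs a) (Suc n) = a n" for n
    using rec[of n] by (simp add: diffs_def numeral_eq_Suc algebra_simps)
  have summ'': "\<And>x. summable (\<lambda>n. diffs (diffs a) n * x ^ n)"
    by (rule termdiff_converges_all[OF summ'])
  have "(\<Sum>n. diffs (diffs a) n * x ^ n) = x * (\<Sum>n. a n * x ^ n)" for x
    using powser_split_head(1)[OF summ''[of x]] a2
    by (simp only: dd) (simp add: diffs_def numeral_2_eq_2)
  moreover have "(\<Sum>n. diffs a n * 0 ^ n) = a 1"
    using powser_zero[of "diffs a"] by (simp add: diffs_def)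
  ultimately show ?thesis
    using termdiffs_strong_converges_everywhere[OF summ]
      termdiffs_strong_converges_everywhere[OF summ']
    by (intro exI[of _ "\<lambda>x. \<Sum>n. diffs a n * x ^ n"]) auto
qed

text \<open>One treatment of both series: q = 1/3, j = 0 is \<open>airy_f\<close>, and q = 2/3, j =
  1 is \<open>airy_g\<close>. The tie q = (j + 1)/3 makes the new Pochhammer factor 3 (q + k) equal
  to n + 1, which cancels one of the three new factors of the factorial and leaves (n + 2)(n + 3).
  Convergence follows by comparing the nonzero coefficients with 1/k!.\<close>

lemma airy_powser:
  fixes q :: real and j :: nat
  assumes q: "0 \<le> q" "q \<le> 1" and j: "j < 2" "q = (real j + 1) / 3"
  defines "a \<equiv> \<lambda>n. if n mod 3 = j then 3 ^ (n div 3) * pochhammer q (n div 3) / fact n else 0"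
  shows "summable (\<lambda>n. a n * x ^ n)"
    and "(\<Sum>n. a n * x ^ n) = (\<Sum>k. 3 ^ k * pochhammer q k * x ^ (3 * k + j) / fact (3 * k + j))"
    and "a 2 = 0" and "a (n + 3) * (real (n + 2) * real (n + 3)) = a n"
proof -
  have a_j: "a (3 * k + j) = 3 ^ k * pochhammer q k / fact (3 * k + j)" for k
    using j by (simp add: a_def)
  show "a 2 = 0" using j by (simp add: a_def)
  show rec: "a (n + 3) * (real (n + 2) * real (n + 3)) = a n" for n
  proof (cases "n mod 3 = j")
    case True
    define k where "k = n div 3"
    have n: "n = 3 * k + j" unfolding k_def using True by presburger
    have "(n + 3) mod 3 = j" "(n + 3) div 3 = Suc k" using True by (simp_all add: k_def)
    then have "a (n + 3) = 3 ^ Suc k * pochhammer q (Suc k) / fact (n + 3)"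
      by (simp add: a_def)
    also have "\<dots> = 3 ^ k * pochhammer q k * (3 * (q + k)) / fact (n + 3)"
      by (simp add: pochhammer_Suc)
    also have "3 * (q + k) = real (n + 1)" by (simp add: j(2) n)
    also have "(fact (n + 3) :: real) = real (n + 1) * real (n + 2) * real (n + 3) * fact n"
      by (simp add: numeral_3_eq_3)
    finally show ?thesis using True by (simp add: a_def k_def)
  qed (simp add: a_def)
  have bound: "\<bar>a (3 * k + j)\<bar> \<le> 1 / fact k" for k
  proof (induction k)
    case 0
    then show ?case using j by (cases j) (auto simp: a_def)
  next
    case (Suc k)
    have "\<bar>a (3 * Suc k + j)\<bar> * (real (3 * k + j + 2) * real (3 * k + j + 3)) = \<bar>a (3 * k + j)\<bar>"
    proof -
      have "3 * k + j + 3 = 3 * Suc k + j" by simp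
      with rec[of "3 * k + j"]
      have "\<bar>a (3 * k + j)\<bar> = \<bar>a (3 * Suc k + j) * (real (3 * k + j + 2) * real (3 * k + j + 3))\<bar>"
        by metis
      also have "\<dots> = \<bar>a (3 * Suc k + j)\<bar> * (real (3 * k + j + 2) * real (3 * k + j + 3))"
        unfolding abs_mult by simp
      finally show ?thesis ..
    qed
    then have "\<bar>a (3 * Suc k + j)\<bar> * (real (3 * k + j + 2) * real (3 * k + j + 3)) \<le> 1 / fact k"
      using Suc by simp
    moreover have "real (Suc k) \<le> real (3 * k + j + 2) * real (3 * k + j + 3)"
    proof -
      have "real (Suc k) * 1 \<le> real (3 * k + j + 2) * real (3 * k + j + 3)"
        by (rule mult_mono) auto
      then show ?thesis by simp
    qed
    ultimately have "\<bar>a (3 * Suc k + j)\<bar> * real (Suc k) \<le> 1 / fact k"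
      by (smt (verit) abs_ge_zero mult_left_mono)
    then have "\<bar>a (3 * Suc k + j)\<bar> \<le> 1 / fact k / real (Suc k)"
      by (subst pos_le_divide_eq) auto
    then show ?case by (simp add: mult.commute)
  qed
  have mono: "strict_mono (\<lambda>k. 3 * k + j)" by (simp add: strict_mono_def)
  have range: "a n * x ^ n = 0" if "n \<notin> range (\<lambda>k. 3 * k + j)" for n
  proof -
    have "n mod 3 \<noteq> j"
    proof
      assume "n mod 3 = j"
      then have "n = 3 * (n div 3) + j" by presburger
      with that show False by blast
    qed
    then show ?thesis by (simp add: a_def)
  qed
  have "summable (\<lambda>k. a (3 * k + j) * x ^ (3 * k + j))"
  proof (rule summable_comparison_test')
    show "summable (\<lambda>k. \<bar>x\<bar> ^ j * (inverse (fact k) * (\<bar>x\<bar> ^ 3) ^ k))"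
      by (intro summable_mult summable_exp)
    show "norm (a (3 * k + j) * x ^ (3 * k + j)) \<le> \<bar>x\<bar> ^ j * (inverse (fact k) * (\<bar>x\<bar> ^ 3) ^ k)" for k
      using mult_right_mono[OF bound[of k], of "\<bar>x\<bar> ^ (3 * k + j)"]
      by (simp add: abs_mult power_abs power_add divide_inverse mult_ac flip: power_mult)
  qed
  then show "summable (\<lambda>n. a n * x ^ n)"
    using summable_mono_reindex[of "\<lambda>k. 3 * k + j" "\<lambda>n. a n * x ^ n"] mono range by simp
  show "(\<Sum>n. a n * x ^ n) = (\<Sum>k. 3 ^ k * pochhammer q k * x ^ (3 * k + j) / fact (3 * k + j))"
    using suminf_mono_reindex[of "\<lambda>k. 3 * k + j" "\<lambda>n. a n * x ^ n"] mono range
    by (simp add: a_j)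
qed

lemma airy_f_ode:
  "\<exists>f'. (\<forall>x. (airy_f has_real_derivative f' x) (at x)) \<and>
        (\<forall>x. (f' has_real_derivative x * airy_f x) (at x)) \<and> airy_f 0 = 1 \<and> f' 0 = 0"
proof -
  define a :: "nat \<Rightarrow> real"
    where "a = (\<lambda>n. if n mod 3 = 0 then 3 ^ (n div 3) * pochhammer (1/3) (n div 3) / fact n else 0)"
  have q: "0 \<le> (1/3 :: real)" "(1/3 :: real) \<le> 1" "0 < (2::nat)" "(1/3 :: real) = (real 0 + 1) / 3"
    by auto
  note p = airy_powser[OF q]
  have ode: "summable (\<lambda>n. a n * x ^ n)" "a 2 = 0" "a (n + 3) * (real (n + 2) * real (n + 3)) = a n" for x n
    unfolding a_def by (rule p(1) p(3) p(4))+
  have eq: "(\<Sum>n. a n * x ^ n) = airy_f x" for x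
    unfolding airy_f_def a_def p(2) by simp
  have "airy_f 0 = 1"
    using powser_zero[of a] eq[of 0] by (simp add: a_def)
  moreover have "a 1 = 0" by (simp add: a_def)
  ultimately show ?thesis
    using powser_airy_ode[OF ode] unfolding eq by metis
qed

lemma airy_g_ode:
  "\<exists>g'. (\<forall>x. (airy_g has_real_derivative g' x) (at x)) \<and>
        (\<forall>x. (g' has_real_derivative x * airy_g x) (at x)) \<and> airy_g 0 = 0 \<and> g' 0 = 1"
proof -
  define a :: "nat \<Rightarrow> real"
    where "a = (\<lambda>n. if n mod 3 = 1 then 3 ^ (n div 3) * pochhammer (2/3) (n div 3) / fact n else 0)"
  have q: "0 \<le> (2/3 :: real)" "(2/3 :: real) \<le> 1" "1 < (2::nat)" "(2/3 :: real) = (real 1 + 1) / 3"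
    by auto
  note p = airy_powser[OF q]
  have ode: "summable (\<lambda>n. a n * x ^ n)" "a 2 = 0" "a (n + 3) * (real (n + 2) * real (n + 3)) = a n" for x n
    unfolding a_def by (rule p(1) p(3) p(4))+
  have eq: "(\<Sum>n. a n * x ^ n) = airy_g x" for x
    unfolding airy_g_def a_def p(2) by simp
  have "airy_g 0 = 0"
    using powser_zero[of a] eq[of 0] by (simp add: a_def)
  moreover have "a 1 = 1" by (simp add: a_def)
  ultimately show ?thesis
    using powser_airy_ode[OF ode] unfolding eq by metis
qed

subsection \<open>The integral for the squared modulus\<close>

text \<open>Up to the sign (-1)^k this is the k-th derivative in s of the case k = 0, the integral
  for the squared modulus; hence only even powers of u occur.\<close>

definition airy_J :: "nat \<Rightarrow> real \<Rightarrow> real" where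
  "airy_J k s = integral {0..} (\<lambda>u. u ^ (2 * k) * exp (- s * u\<^sup>2 - u ^ 6 / 12))"

text \<open>The spare u on the left pays for any power of u through u^n \<le> n! exp u, and the -u
  on the right leaves the integrable majorant exp(-u). With v = u^2 and 2 u \<le> v + 1 everything
  reduces to T v - v^3/12, which is nonpositive once v exceeds 12 T + 1.\<close>

lemma airy_J_exponent_bound:
  fixes u s :: real
  assumes "u \<ge> 0"
  shows "u - s * u\<^sup>2 - u ^ 6 / 12 \<le> 1 + (\<bar>s\<bar> + 1) * (12 * (\<bar>s\<bar> + 1) + 1) - u"
proof -
  define v T where "v = u\<^sup>2" and "T = \<bar>s\<bar> + 1"
  have v0: "v \<ge> 0" and T: "T \<ge> 1" by (auto simp: v_def T_def)
  have "T * v - v ^ 3 / 12 \<le> T * (12 * T + 1)"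
  proof (cases "v \<le> 12 * T + 1")
    case True
    then have "T * v \<le> T * (12 * T + 1)" using T by simp
    moreover have "v ^ 3 / 12 \<ge> 0" using v0 by simp
    ultimately show ?thesis by linarith
  next
    case False
    then have "v * 1 \<le> v * v" "12 * T \<le> v" using T v0 by (auto intro!: mult_left_mono)
    then have "12 * T * v \<le> (v * v) * v" using v0 by (intro mult_right_mono) auto
    then have "T * v - v ^ 3 / 12 \<le> 0" by (simp add: power3_eq_cube)
    moreover have "0 \<le> T * (12 * T + 1)" using T by simp
    ultimately show ?thesis by linarith
  qed
  moreover have "2 * u \<le> v + 1" unfolding v_def
    using zero_le_power2[of "u - 1"] by (simp add: power2_eq_square algebra_simps)
  moreover have "- s * v \<le> \<bar>s\<bar> * v" using v0 by (intro mult_right_mono) auto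
  moreover have "u ^ 6 = v ^ 3" by (simp add: v_def power_mult[symmetric])
  ultimately show ?thesis unfolding v_def[symmetric] T_def[symmetric]
    by (simp add: T_def algebra_simps)
qed

lemma power_le_fact_exp:
  fixes u :: real
  assumes "u \<ge> 0"
  shows "u ^ n \<le> fact n * exp u"
proof -
  have "(\<lambda>n. u ^ n /\<^sub>R fact n) sums exp u" by (rule exp_converges)
  then have "(\<Sum>i\<in>{n}. u ^ i /\<^sub>R fact i) \<le> exp u"
    using assms by (intro sum_le_suminf[of "\<lambda>n. u ^ n /\<^sub>R fact n" "{n}", THEN order_trans])
      (auto simp: sums_iff)
  then show ?thesis by (simp add: field_simps)
qed

lemma airy_J_integrable:
  fixes s :: real
  shows "(\<lambda>u. u ^ n * exp (- s * u\<^sup>2 - u ^ 6 / 12)) integrable_on {0..}" (is "?f integrable_on _")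
proof (rule measurable_bounded_by_integrable_imp_integrable)
  define D where "D = fact n * exp (1 + (\<bar>s\<bar> + 1) * (12 * (\<bar>s\<bar> + 1) + 1))"
  show "?f \<in> borel_measurable (lebesgue_on {0..})"
    by (intro continuous_imp_measurable_on_sets_lebesgue continuous_intros) auto
  show "(\<lambda>u. D * exp (- 1 * u)) integrable_on {0..}"
    by (intro integrable_on_mult_right integrable_on_exp_minus_to_infinity) auto
  fix u :: real assume u: "u \<in> {0..}"
  then have "norm (?f u) = u ^ n * exp (- s * u\<^sup>2 - u ^ 6 / 12)" by simp
  also have "\<dots> \<le> (fact n * exp u) * exp (- s * u\<^sup>2 - u ^ 6 / 12)"
    using u by (intro mult_right_mono power_le_fact_exp) auto
  also have "\<dots> = fact n * exp (u - s * u\<^sup>2 - u ^ 6 / 12)"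
    by (simp add: exp_add[symmetric] exp_diff exp_minus field_simps)
  also have "\<dots> \<le> fact n * exp (1 + (\<bar>s\<bar> + 1) * (12 * (\<bar>s\<bar> + 1) + 1) - u)"
    using airy_J_exponent_bound[of u s] u by simp
  also have "\<dots> = D * exp (- 1 * u)"
    by (simp add: D_def exp_diff exp_minus field_simps)
  finally show "norm (?f u) \<le> D * exp (- 1 * u)" .
qed auto

lemma airy_J_has_integral:
  "((\<lambda>u. u ^ (2 * k) * exp (- s * u\<^sup>2 - u ^ 6 / 12)) has_integral airy_J k s) {0..}"
  unfolding airy_J_def by (intro integrable_integral airy_J_integrable)

lemma exp_taylor2_bound:
  fixes y :: real
  shows "\<bar>exp y - 1 - y\<bar> \<le> y\<^sup>2 / 2 * exp \<bar>y\<bar>"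
proof (cases "y = 0")
  case False
  then obtain t where t: "\<bar>t\<bar> \<le> \<bar>y\<bar>" "exp y = (\<Sum>m<2. y ^ m / fact m) + exp t / fact 2 * y ^ 2"
    using Maclaurin_exp_le[of y 2] by auto
  then have "exp y - 1 - y = exp t / 2 * y\<^sup>2" by (simp add: numeral_2_eq_2)
  then have "\<bar>exp y - 1 - y\<bar> = \<bar>exp t / 2 * y\<^sup>2\<bar>" by (simp only:)
  also have "\<dots> = y\<^sup>2 / 2 * exp t" by (simp add: abs_mult)
  also have "\<dots> \<le> y\<^sup>2 / 2 * exp \<bar>y\<bar>" using t by (intro mult_left_mono) auto
  finally show ?thesis .
qed simp

text \<open>Differentiation under the integral with an explicit remainder. The second-order Taylor
  error contributes h^2 u^4 / 2, which raises the index to k + 2, and a factor exp(|h| u^2) \<le>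
  exp(u^2) for |h| \<le> 1, which moves s to s - 1. The error is therefore at most h^2/2 times a
  finite moment.\<close>

lemma airy_J_deriv:
  "(airy_J k has_real_derivative - airy_J (Suc k) s) (at s)"
proof -
  define D where "D = airy_J (k + 2) (s - 1)"
  have bound: "\<bar>airy_J k (s + h) - airy_J k s + h * airy_J (Suc k) s\<bar> \<le> h\<^sup>2 / 2 * D" if h: "\<bar>h\<bar> \<le> 1" for h
  proof -
    let ?e = "\<lambda>s u. exp (- s * u\<^sup>2 - u ^ 6 / 12) :: real"
    have int: "((\<lambda>u. u ^ (2*k) * ?e (s + h) u - u ^ (2*k) * ?e s u + h * (u ^ (2*Suc k) * ?e s u))
        has_integral (airy_J k (s + h) - airy_J k s + h * airy_J (Suc k) s)) {0..}"
      by (intro has_integral_add has_integral_diff has_integral_mult_right airy_J_has_integral)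
    have int2: "((\<lambda>u. h\<^sup>2 / 2 * (u ^ (2*(k+2)) * ?e (s - 1) u)) has_integral h\<^sup>2 / 2 * D) {0..}"
      unfolding D_def by (intro has_integral_mult_right airy_J_has_integral)
    have pw: "norm (u ^ (2*k) * ?e (s + h) u - u ^ (2*k) * ?e s u + h * (u ^ (2*Suc k) * ?e s u))
       \<le> h\<^sup>2 / 2 * (u ^ (2*(k+2)) * ?e (s - 1) u)" for u
    proof -
      have 1: "?e (s + h) u = ?e s u * exp (- h * u\<^sup>2)"
        by (simp add: exp_add[symmetric] algebra_simps)
      have "u ^ (2*k) * ?e (s + h) u - u ^ (2*k) * ?e s u + h * (u ^ (2*Suc k) * ?e s u)
         = u ^ (2*k) * ?e s u * (exp (- h * u\<^sup>2) - 1 - (- h * u\<^sup>2))"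
        unfolding 1 by (simp add: algebra_simps power2_eq_square)
      also have "norm \<dots> = u ^ (2*k) * ?e s u * \<bar>exp (- h * u\<^sup>2) - 1 - (- h * u\<^sup>2)\<bar>"
        by (simp add: abs_mult)
      also have "\<dots> \<le> u ^ (2*k) * ?e s u * ((- h * u\<^sup>2)\<^sup>2 / 2 * exp \<bar>- h * u\<^sup>2\<bar>)"
        by (intro mult_left_mono exp_taylor2_bound) auto
      also have "\<dots> \<le> u ^ (2*k) * ?e s u * ((- h * u\<^sup>2)\<^sup>2 / 2 * exp (u\<^sup>2))"
        using h mult_right_mono[of "\<bar>h\<bar>" 1 "u\<^sup>2"]
        by (intro mult_left_mono) (auto simp: abs_mult)
      also have "?e s u * exp (u\<^sup>2) = ?e (s - 1) u"
        by (simp add: exp_add[symmetric] algebra_simps)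
      then have "u ^ (2*k) * ?e s u * ((- h * u\<^sup>2)\<^sup>2 / 2 * exp (u\<^sup>2))
          = h\<^sup>2 / 2 * (u ^ (2*(k+2)) * ?e (s - 1) u)"
        by (simp add: power_mult_distrib power_add flip: power_mult)
           (simp add: power_mult algebra_simps power4_eq_xxxx)
      finally show ?thesis .
    qed
    have "norm (integral {0..} (\<lambda>u. u ^ (2*k) * ?e (s + h) u - u ^ (2*k) * ?e s u + h * (u ^ (2*Suc k) * ?e s u)))
       \<le> integral {0..} (\<lambda>u. h\<^sup>2 / 2 * (u ^ (2*(k+2)) * ?e (s - 1) u))"
      using int int2 pw by (intro integral_norm_bound_integral) (auto simp: integrable_on_def)
    then show ?thesis unfolding integral_unique[OF int] integral_unique[OF int2] real_norm_def .
  qed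
  have "(\<lambda>h. (airy_J k (s + h) - airy_J k s) / h) \<midarrow>0\<rightarrow> - airy_J (Suc k) s"
  proof (rule LIM_zero_cancel, rule Lim_null_comparison)
    show "\<forall>\<^sub>F h in at 0. norm ((airy_J k (s + h) - airy_J k s) / h - - airy_J (Suc k) s) \<le> \<bar>h\<bar> / 2 * D"
      unfolding eventually_at
    proof (intro exI[of _ 1] conjI ballI impI)
      fix h :: real assume h: "h \<noteq> 0 \<and> dist h 0 < 1"
      then have "\<bar>airy_J k (s + h) - airy_J k s + h * airy_J (Suc k) s\<bar> / \<bar>h\<bar> \<le> h\<^sup>2 / 2 * D / \<bar>h\<bar>"
        by (intro divide_right_mono bound) auto
      also have "h\<^sup>2 / 2 * D / \<bar>h\<bar> = \<bar>h\<bar> / 2 * D"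
        using h by (cases "h > 0") (auto simp: power2_eq_square)
      finally show "norm ((airy_J k (s + h) - airy_J k s) / h - - airy_J (Suc k) s) \<le> \<bar>h\<bar> / 2 * D"
        using h by (simp add: abs_divide[symmetric] add_divide_distrib)
    qed auto
    have "((\<lambda>h. \<bar>h\<bar> / 2 * D) \<longlongrightarrow> \<bar>0\<bar> / 2 * D) (at 0)"
      by (intro tendsto_intros) auto
    then show "((\<lambda>h. \<bar>h\<bar> / 2 * D) \<longlongrightarrow> 0) (at 0)" by simp
  qed
  then show ?thesis by (simp add: DERIV_def)
qed

section \<open>Recurrence and values at 0 of the moments\<close>

lemma has_integral_FTC_at_top:
  fixes F f :: "real \<Rightarrow> real"
  assumes int: "f absolutely_integrable_on {a..}"
    and deriv: "\<And>x. x \<ge> a \<Longrightarrow> (F has_real_derivative f x) (at x)"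
    and lim: "(F \<longlongrightarrow> T) at_top"
  shows "(f has_integral (T - F a)) {a..}"
proof -
  have *: "set_lebesgue_integral lebesgue {a..b} f = F b - F a" if "b \<ge> a" for b
  proof -
    have "f absolutely_integrable_on {a..b}"
      by (rule set_integrable_subset[OF int]) auto
    moreover have "(f has_integral (F b - F a)) {a..b}"
      using that deriv
      by (intro fundamental_theorem_of_calculus)
         (auto simp: has_real_derivative_iff_has_vector_derivative[symmetric] intro: DERIV_subset)
    ultimately show ?thesis
      using set_lebesgue_integral_eq_integral(2) integral_unique by metis
  qed
  have "((\<lambda>b. set_lebesgue_integral lebesgue {a..b} f) \<longlongrightarrow> set_lebesgue_integral lebesgue {a..} f) at_top"
    by (rule tendsto_set_lebesgue_integral_at_top[OF _ int]) auto
  moreover have "((\<lambda>b. set_lebesgue_integral lebesgue {a..b} f) \<longlongrightarrow> T - F a) at_top"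
  proof (rule Lim_transform_eventually)
    show "((\<lambda>b. F b - F a) \<longlongrightarrow> T - F a) at_top" by (intro tendsto_intros lim)
    show "\<forall>\<^sub>F b in at_top. F b - F a = set_lebesgue_integral lebesgue {a..b} f"
      using eventually_ge_at_top[of a] by eventually_elim (simp add: *)
  qed
  ultimately have "set_lebesgue_integral lebesgue {a..} f = T - F a"
    using tendsto_unique trivial_limit_at_top_linorder by blast
  then show ?thesis
    using set_lebesgue_integral_eq_integral[OF int] integrable_integral by metis
qed

text \<open>The derivative of u exp(-s u^2 - u^6/12) is integrated; its boundary terms vanish at 0
  and at infinity. Since \<open>airy_J (Suc k)\<close> is minus the derivative of
  \<open>airy_J k\<close>, the identity is the equation y''' = -4 s y' - 2 y for y =
  \<open>airy_J 0\<close>.\<close>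

lemma airy_J_recurrence: "airy_J 3 s = 2 * airy_J 0 s - 4 * s * airy_J 1 s"
proof -
  let ?e = "\<lambda>u. exp (- s * u\<^sup>2 - u ^ 6 / 12) :: real"
  let ?f = "\<lambda>u. u ^ (2*0) * ?e u - 2 * s * (u ^ (2*1) * ?e u) - 1/2 * (u ^ (2*3) * ?e u)"
  have abs: "(\<lambda>u. u ^ (2*k) * ?e u) absolutely_integrable_on {0..}" for k
    by (rule nonnegative_absolutely_integrable_1[OF airy_J_integrable]) auto
  have "(?f has_integral (0 - 0 * ?e 0)) {0..}"
  proof (rule has_integral_FTC_at_top)
    show "?f absolutely_integrable_on {0..}"
      by (intro set_integral_diff abs set_integrable_mult_right) 
    show "((\<lambda>u. u * ?e u) has_real_derivative ?f u) (at u)" for u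
      by (auto intro!: derivative_eq_intros simp: algebra_simps power2_eq_square numeral_eq_Suc)
    show "((\<lambda>u. u * ?e u) \<longlongrightarrow> 0) at_top"
    proof (rule Lim_null_comparison)
      define D where "D = exp (1 + (\<bar>s\<bar> + 1) * (12 * (\<bar>s\<bar> + 1) + 1))"
      show "\<forall>\<^sub>F u in at_top. norm (u * ?e u) \<le> D * exp (- u)"
        using eventually_ge_at_top[of 0]
      proof eventually_elim
        case (elim u)
        then have "norm (u * ?e u) \<le> exp u * ?e u"
          using power_le_fact_exp[of u 1] by (simp add: abs_mult)
        also have "\<dots> = exp (u - s * u\<^sup>2 - u ^ 6 / 12)"
          by (simp add: exp_add[symmetric] algebra_simps)
        also have "\<dots> \<le> exp (1 + (\<bar>s\<bar> + 1) * (12 * (\<bar>s\<bar> + 1) + 1) - u)"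
          using airy_J_exponent_bound[of u s] elim by simp
        finally show ?case by (simp add: D_def exp_diff exp_minus field_simps)
      qed
      have "((\<lambda>u. D * exp (- u)) \<longlongrightarrow> D * 0) at_top"
        by (intro tendsto_mult tendsto_const filterlim_compose[OF exp_at_bot filterlim_uminus_at_bot_at_top])
      then show "((\<lambda>u. D * exp (- u)) \<longlongrightarrow> 0) at_top" by simp
    qed
  qed
  moreover have "(?f has_integral (airy_J 0 s - 2 * s * airy_J 1 s - 1/2 * airy_J 3 s)) {0..}"
    by (intro has_integral_diff has_integral_mult_right airy_J_has_integral)
  ultimately have "airy_J 0 s - 2 * s * airy_J 1 s - 1/2 * airy_J 3 s = 0 - 0 * ?e 0"
    using has_integral_unique by blast
  then show ?thesis by simp
qed

text \<open>The substitution t = u^6/12 produces the Gamma integral at (2k+1)/6; for k = 0, 1, 2 the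
  arguments are 1/6, 1/2 and 5/6.\<close>

lemma airy_J_at_0: "airy_J k 0 = 2 * 12 powr ((2 * k + 1) / 6 - 1) * Gamma ((2 * k + 1) / 6)"
proof -
  define x where "x = (2 * real k + 1) / 6"
  have x: "x > 0" by (simp add: x_def)
  define f :: "real \<Rightarrow> real" where "f = (\<lambda>t. t powr (x - 1) / exp t)"
  \<comment> \<open>The endpoint has to go: for k = 0 the pointwise identity \<open>eq\<close> below
    fails at u = 0, where its left side is 0 and its right side is positive.\<close>
  have spike: "(g has_integral y) {0<..} \<longleftrightarrow> (g has_integral y) {0..}" for g :: "real \<Rightarrow> real" and y
    by (rule has_integral_spike_set_eq) (auto intro: negligible_subset[of "{0}"])
  have "(f has_integral Gamma x) {0..}"
    unfolding f_def by (rule Gamma_integral_real[OF x])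
  then have f: "(f has_integral Gamma x) {0<..}"
    by (simp only: spike)
  then have fabs: "f absolutely_integrable_on {0<..}"
    by (intro nonnegative_absolutely_integrable_1) (auto simp: f_def integrable_on_def)
  have img: "(\<lambda>u::real. u ^ 6 / 12) ` {0<..} = {0<..}"
  proof (intro subset_antisym subsetI)
    fix t :: real assume t: "t \<in> {0<..}"
    then have "t = (root 6 (12 * t)) ^ 6 / 12" "root 6 (12 * t) > 0" by simp_all
    then show "t \<in> (\<lambda>u::real. u ^ 6 / 12) ` {0<..}" by (intro image_eqI[of _ _ "root 6 (12 * t)"]) simp_all
  qed auto
  have inj: "inj_on (\<lambda>u::real. u ^ 6 / 12) {0<..}"
    by (auto intro!: inj_onI simp: power_eq_iff_eq_base)
  have "(\<lambda>u. \<bar>u ^ 5 / 2\<bar> * f (u ^ 6 / 12)) absolutely_integrable_on {0<..} \<and>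
        integral {0<..} (\<lambda>u. \<bar>u ^ 5 / 2\<bar> * f (u ^ 6 / 12)) = Gamma x"
    by (subst has_absolute_integral_change_of_variables_1')
       (use inj f fabs in \<open>auto intro!: derivative_eq_intros simp: img integral_unique\<close>)
  then have G: "((\<lambda>u. \<bar>u ^ 5 / 2\<bar> * f (u ^ 6 / 12)) has_integral Gamma x) {0<..}"
    by (metis absolutely_integrable_on_def integrable_integral)
  have eq: "\<bar>u ^ 5 / 2\<bar> * f (u ^ 6 / 12)
      = 12 powr (1 - x) / 2 * (u ^ (2 * k) * exp (- 0 * u\<^sup>2 - u ^ 6 / 12))" if "u > 0" for u
  proof -
    have "u powr 5 = u ^ 5" "u powr 6 = u ^ 6" using that by (simp_all add: powr_numeral)
    then have "u ^ 5 * (u ^ 6 / 12) powr (x - 1) = u powr 5 * ((u powr 6) powr (x - 1) / 12 powr (x - 1))"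
      using that by (simp only: powr_divide)
    also have "\<dots> = u powr (5 + 6 * (x - 1)) * 12 powr (1 - x)"
      using powr_minus_divide[of 12 "x - 1"] powr_add[of u 5 "6 * (x - 1)"]
      by (simp add: powr_powr algebra_simps)
    also have "5 + 6 * (x - 1) = real (2 * k)" by (simp add: x_def field_simps)
    also have "u powr real (2 * k) = u ^ (2 * k)" using that by (rule powr_realpow)
    finally have "u ^ 5 * (u ^ 6 / 12) powr (x - 1) = u ^ (2 * k) * 12 powr (1 - x)" .
    then show ?thesis using that
      by (simp add: f_def abs_mult exp_minus field_simps)
  qed
  have "((\<lambda>u. 12 powr (1 - x) / 2 * (u ^ (2 * k) * exp (- 0 * u\<^sup>2 - u ^ 6 / 12))) has_integral Gamma x) {0<..}"
    by (rule has_integral_eq[OF _ G]) (use eq in auto)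
  moreover have "((\<lambda>u. 12 powr (1 - x) / 2 * (u ^ (2 * k) * exp (- 0 * u\<^sup>2 - u ^ 6 / 12)))
      has_integral 12 powr (1 - x) / 2 * airy_J k 0) {0<..}"
    unfolding spike by (intro has_integral_mult_right airy_J_has_integral)
  ultimately have "12 powr (1 - x) / 2 * airy_J k 0 = Gamma x"
    using has_integral_unique by blast
  then have "airy_J k 0 = 2 / 12 powr (1 - x) * Gamma x"
    by (simp add: field_simps)
  also have "2 / 12 powr (1 - x) = 2 * 12 powr (x - 1)"
    using powr_minus_divide[of 12 "1 - x"] by simp
  finally show ?thesis by (simp add: x_def)
qed

section \<open>Size of the moments\<close>

text \<open>Only the range [0, r] is kept, on which the exponent is at least -|s| r^2 - 1/12. The
  choice r = 1 yields positivity; r = 1/sqrt s, the width of the Gaussian, yields a lower bound of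
  the right order s^(-k-1/2).\<close>

lemma airy_J_ge:
  fixes s r :: real
  assumes r: "0 < r" "r \<le> 1"
  shows "exp (- \<bar>s\<bar> * r\<^sup>2 - 1 / 12) * (r ^ (2 * k + 1) / (2 * k + 1)) \<le> airy_J k s"
proof -
  let ?c = "exp (- \<bar>s\<bar> * r\<^sup>2 - 1 / 12)"
  have 1: "((\<lambda>u. ?c * u ^ (2 * k)) has_integral ?c * (r ^ (2 * k + 1) / (2 * k + 1))) {0..r}"
  proof -
    have "((\<lambda>u. u ^ (2 * k)) has_integral
        r ^ (2 * k + 1) / real (2 * k + 1) - 0 ^ (2 * k + 1) / real (2 * k + 1)) {0..r}"
      using r
      by (intro fundamental_theorem_of_calculus)
         (auto simp: has_real_derivative_iff_has_vector_derivative[symmetric]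
           intro!: derivative_eq_intros simp del: of_nat_mult of_nat_add power_Suc)
    then show ?thesis by (intro has_integral_mult_right) simp
  qed
  have "?c * (r ^ (2 * k + 1) / (2 * k + 1)) = integral {0..r} (\<lambda>u. ?c * u ^ (2 * k))"
    by (rule integral_unique[OF 1, symmetric])
  also have "\<dots> \<le> integral {0..r} (\<lambda>u. u ^ (2 * k) * exp (- s * u\<^sup>2 - u ^ 6 / 12))"
  proof (rule integral_le)
    show "(\<lambda>u. ?c * u ^ (2 * k)) integrable_on {0..r}" using 1 by blast
    show "(\<lambda>u. u ^ (2 * k) * exp (- s * u\<^sup>2 - u ^ 6 / 12)) integrable_on {0..r}"
      by (intro integrable_continuous_real continuous_intros) auto
    fix u assume u: "u \<in> {0..r}"
    then have "u ^ 6 \<le> 1" using r by (intro power_le_one) auto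
    moreover have "s * u\<^sup>2 \<le> \<bar>s\<bar> * r\<^sup>2" using u by (intro mult_mono power_mono) auto
    ultimately show "?c * u ^ (2 * k) \<le> u ^ (2 * k) * exp (- s * u\<^sup>2 - u ^ 6 / 12)"
      by (subst mult.commute, intro mult_left_mono) auto
  qed
  also have "\<dots> \<le> airy_J k s" unfolding airy_J_def
  proof (rule integral_subset_le)
    show "(\<lambda>u. u ^ (2 * k) * exp (- s * u\<^sup>2 - u ^ 6 / 12)) integrable_on {0..r}"
      by (intro integrable_continuous_real continuous_intros) auto
  qed (use airy_J_integrable in auto)
  finally show ?thesis by (simp add: mult_ac)
qed

lemma airy_J_pos: "airy_J k s > 0"
proof -
  have "0 < exp (- \<bar>s\<bar> * 1\<^sup>2 - 1 / 12) * (1 ^ (2 * k + 1) / (2 * real k + 1))" by simp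
  also have "\<dots> \<le> airy_J k s" using airy_J_ge[of 1 s k] by (simp add: add.commute)
  finally show ?thesis .
qed

lemma airy_J_lower:
  assumes "s \<ge> 1"
  shows "exp (- 13 / 12) * ((1 / sqrt s) ^ (2 * k + 1) / (2 * k + 1)) \<le> airy_J k s"
  using airy_J_ge[of "1 / sqrt s" s k] assms by (simp add: power_divide)

text \<open>The sextic term is dropped and (sqrt s u - 1)^2 \<ge> 0 replaces the Gaussian by an
  exponential. This loses a constant factor but keeps the order s^(-1/2) of the lower bound.\<close>

lemma airy_J_upper:
  assumes "s > 0"
  shows "airy_J 0 s \<le> exp 1 / (2 * sqrt s)"
proof (rule has_integral_le[OF airy_J_has_integral])
  have "((\<lambda>u. exp 1 * exp (- (2 * sqrt s) * u)) has_integral (exp 1 * (exp (- (2 * sqrt s) * 0) / (2 * sqrt s)))) {0..}"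
    using assms by (intro has_integral_mult_right has_integral_exp_minus_to_infinity) auto
  then show "((\<lambda>u. exp 1 * exp (- (2 * sqrt s) * u)) has_integral (exp 1 / (2 * sqrt s))) {0..}"
    by simp
  fix u :: real
  have "0 \<le> (sqrt s * u - 1)\<^sup>2" by simp
  also have "\<dots> = s * u\<^sup>2 + 1 - 2 * sqrt s * u"
    using assms by (simp add: power2_eq_square algebra_simps)
  finally have "- s * u\<^sup>2 \<le> 1 - 2 * sqrt s * u" by simp
  moreover have "0 \<le> u ^ 6 / 12" by simp
  ultimately have "- s * u\<^sup>2 - u ^ 6 / 12 \<le> 1 + - (2 * sqrt s) * u" by linarith
  then have "exp (- s * u\<^sup>2 - u ^ 6 / 12) \<le> exp 1 * exp (- (2 * sqrt s) * u)"
    by (subst exp_add[symmetric]) simp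
  then show "u ^ (2 * 0) * exp (- s * u\<^sup>2 - u ^ 6 / 12) \<le> exp 1 * exp (- (2 * sqrt s) * u)"
    by simp
qed

section \<open>Identification of the squared modulus with the integral\<close>

definition airy_M :: "real \<Rightarrow> real" where
  "airy_M s = (airy_Ai (- s))\<^sup>2 + (airy_Bi (- s))\<^sup>2"

text \<open>A Gronwall argument for W = y^2 + y'^2 + y''^2. On [-|s|, |s|] one has |W'| \<le> K W
  with K = 4 + 4 |s|, so W exp(-K t) is nonincreasing to the right of 0 and W exp(K t) nondecreasing
  to the left; W 0 = 0 then forces W s \<le> 0.\<close>

lemma airy_product_ode_unique:
  fixes y y' y'' :: "real \<Rightarrow> real"
  assumes d: "\<And>s. (y has_real_derivative y' s) (at s)"
    "\<And>s. (y' has_real_derivative y'' s) (at s)"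
    "\<And>s. (y'' has_real_derivative - (4 * s * y' s + 2 * y s)) (at s)"
    and z: "y 0 = 0" "y' 0 = 0" "y'' 0 = 0"
  shows "y s = 0"
proof -
  define W where "W s = (y s)\<^sup>2 + (y' s)\<^sup>2 + (y'' s)\<^sup>2" for s
  define W' where "W' s = 2 * y s * y' s + 2 * y' s * y'' s - 2 * y'' s * (4 * s * y' s + 2 * y s)" for s
  have dW: "(W has_real_derivative W' s) (at s)" for s
    unfolding W_def W'_def
    by (auto intro!: derivative_eq_intros d simp: algebra_simps power2_eq_square)
  have bound: "\<bar>W' t\<bar> \<le> (4 + 4 * \<bar>s\<bar>) * W t" if "\<bar>t\<bar> \<le> \<bar>s\<bar>" for t
  proof -
    have ab: "\<bar>2 * a * b\<bar> \<le> a\<^sup>2 + b\<^sup>2" for a b :: real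
      using sum_squares_bound[of a b] sum_squares_bound[of "- a" b] by (simp add: abs_le_iff)
    have Wt: "W t = (y t)\<^sup>2 + (y' t)\<^sup>2 + (y'' t)\<^sup>2" by (simp add: W_def)
    have "\<bar>4 * t * (2 * y'' t * y' t)\<bar> = 4 * \<bar>t\<bar> * \<bar>2 * y'' t * y' t\<bar>"
      by (simp add: abs_mult)
    also have "\<dots> \<le> 4 * \<bar>s\<bar> * ((y'' t)\<^sup>2 + (y' t)\<^sup>2)"
      using that by (intro mult_mono ab) auto
    also have "\<dots> \<le> 4 * \<bar>s\<bar> * W t" by (intro mult_left_mono) (auto simp: W_def)
    finally have "\<bar>4 * t * (2 * y'' t * y' t)\<bar> \<le> 4 * \<bar>s\<bar> * W t" .
    moreover have "W' t = 2 * y t * y' t + 2 * y' t * y'' t - 4 * t * (2 * y'' t * y' t) - 2 * (2 * y'' t * y t)"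
      by (simp add: W'_def algebra_simps)
    moreover have "(4 + 4 * \<bar>s\<bar>) * W t = 4 * \<bar>s\<bar> * W t + 4 * W t" by (simp add: algebra_simps)
    moreover have "(y t)\<^sup>2 \<ge> 0" "(y' t)\<^sup>2 \<ge> 0" "(y'' t)\<^sup>2 \<ge> 0" by auto
    ultimately show ?thesis
      using ab[of "y t" "y' t"] ab[of "y' t" "y'' t"] ab[of "y'' t" "y t"]
        Wt by linarith
  qed
  define K where "K = 4 + 4 * \<bar>s\<bar>"
  have W0: "W 0 = 0" by (simp add: W_def z)
  have "W s \<le> 0"
  proof (cases "s \<ge> 0")
    case True
    have "W s * exp (- K * s) \<le> W 0 * exp (- K * 0)"
    proof (rule DERIV_nonpos_imp_nonincreasing[OF True])
      fix t assume t: "0 \<le> t" "t \<le> s"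
      have "((\<lambda>t. W t * exp (- K * t)) has_real_derivative (W' t - K * W t) * exp (- K * t)) (at t)"
        by (auto intro!: derivative_eq_intros dW simp: algebra_simps)
      moreover have "(W' t - K * W t) * exp (- K * t) \<le> 0"
        using bound[of t] t by (intro mult_nonpos_nonneg) (auto simp: K_def)
      ultimately show "\<exists>y. ((\<lambda>t. W t * exp (- K * t)) has_real_derivative y) (at t) \<and> y \<le> 0" by blast
    qed
    then show ?thesis using W0 by (simp add: mult_le_0_iff)
  next
    case False
    then have "s \<le> 0" by simp
    have "W s * exp (K * s) \<le> W 0 * exp (K * 0)"
    proof (rule DERIV_nonneg_imp_nondecreasing[OF \<open>s \<le> 0\<close>])
      fix t assume t: "s \<le> t" "t \<le> 0"
      have "((\<lambda>t. W t * exp (K * t)) has_real_derivative (W' t + K * W t) * exp (K * t)) (at t)"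
        by (auto intro!: derivative_eq_intros dW simp: algebra_simps)
      moreover have "(W' t + K * W t) * exp (K * t) \<ge> 0"
        using bound[of t] t by (intro mult_nonneg_nonneg) (auto simp: K_def)
      ultimately show "\<exists>y. ((\<lambda>t. W t * exp (K * t)) has_real_derivative y) (at t) \<and> 0 \<le> y" by blast
    qed
    then show ?thesis using W0 by (simp add: mult_le_0_iff)
  qed
  moreover have "(y s)\<^sup>2 \<le> W s" by (simp add: W_def)
  ultimately have "(y s)\<^sup>2 \<le> 0" by linarith
  then show ?thesis by simp
qed

lemma airy_Ai_Bi_ode:
  obtains Ai' Bi' where
    "\<And>x. (airy_Ai has_real_derivative Ai' x) (at x)" "\<And>x. (airy_Bi has_real_derivative Bi' x) (at x)"
    "\<And>x. (Ai' has_real_derivative x * airy_Ai x) (at x)" "\<And>x. (Bi' has_real_derivative x * airy_Bi x) (at x)"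
    "airy_Ai 0 = airy_c1" "airy_Bi 0 = sqrt 3 * airy_c1"
    "Ai' 0 = - airy_c2" "Bi' 0 = sqrt 3 * airy_c2"
proof -
  obtain f' where f: "\<And>x. (airy_f has_real_derivative f' x) (at x)"
    "\<And>x. (f' has_real_derivative x * airy_f x) (at x)" "airy_f 0 = 1" "f' 0 = 0"
    using airy_f_ode by metis
  obtain g' where g: "\<And>x. (airy_g has_real_derivative g' x) (at x)"
    "\<And>x. (g' has_real_derivative x * airy_g x) (at x)" "airy_g 0 = 0" "g' 0 = 1"
    using airy_g_ode by metis
  note * = derivative_eq_intros f(1,2) g(1,2)
  have eq: "airy_Ai = (\<lambda>x. airy_c1 * airy_f x - airy_c2 * airy_g x)"
    "airy_Bi = (\<lambda>x. sqrt 3 * (airy_c1 * airy_f x + airy_c2 * airy_g x))"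
    by (auto simp: airy_Ai_def airy_Bi_def)
  show ?thesis
    by (rule that[of "\<lambda>x. airy_c1 * f' x - airy_c2 * g' x" "\<lambda>x. sqrt 3 * (airy_c1 * f' x + airy_c2 * g' x)"])
       (unfold eq, auto intro!: * simp: f g algebra_simps)
qed

text \<open>The reflection formula at 1/3, where sin(pi/3) = sqrt 3 / 2. Times 2 sqrt 3, this
  product is the Wronskian of Ai and Bi at 0.\<close>

lemma airy_c1_c2: "airy_c1 * airy_c2 = 1 / (2 * sqrt 3 * pi)"
proof -
  have "complex_of_real (Gamma (1/3) * Gamma (2/3)) = Gamma (of_real (1/3)) * Gamma (of_real (2/3))"
    by (simp only: of_real_mult Gamma_complex_of_real)
  also have "complex_of_real (2/3) = 1 - of_real (1/3)" by simp
  also have "Gamma (complex_of_real (1/3)) * Gamma (1 - of_real (1/3)) = of_real pi / sin (of_real pi * of_real (1/3))"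
    by (rule Gamma_reflection_complex)
  also have "\<dots> = of_real (pi / sin (pi * (1/3)))"
    by (simp only: of_real_mult[symmetric] sin_of_real of_real_divide[symmetric])
  finally have "complex_of_real (Gamma (1/3) * Gamma (2/3)) = of_real (pi / sin (pi * (1/3)))" .
  then have "Gamma (1/3) * Gamma (2/3) = pi / sin (pi * (1/3))" by (subst (asm) of_real_eq_iff)
  then have G: "Gamma (1/3) * Gamma (2/3) = 2 * pi / sqrt 3" using sin_60 by simp
  have "airy_c1 * airy_c2 = 1 / ((3 powr (2/3) * 3 powr (1/3)) * (2 * pi / sqrt 3))"
    unfolding G[symmetric] by (simp add: airy_c1_def airy_c2_def)
  also have "(3::real) powr (2/3) * 3 powr (1/3) = 3" by (simp flip: powr_add)
  also have "3 * (2 * pi / sqrt 3) = 2 * sqrt 3 * pi"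
    using real_div_sqrt[of 3] by (simp add: field_simps)
  finally show ?thesis .
qed

lemma Gamma_duplication_real:
  fixes x :: real
  assumes "x > 0"
  shows "Gamma x * Gamma (x + 1/2) = 2 powr (1 - 2 * x) * sqrt pi * Gamma (2 * x)"
proof -
  have "complex_of_real x \<notin> \<int>\<^sub>\<le>\<^sub>0" "complex_of_real x + 1/2 \<notin> \<int>\<^sub>\<le>\<^sub>0"
    using assms by (auto elim!: nonpos_Ints_cases simp: complex_eq_iff)
  from Gamma_legendre_duplication[OF this]
  have "complex_of_real (Gamma x * Gamma (x + 1/2)) = of_real (exp ((1 - 2 * x) * ln 2) * sqrt pi * Gamma (2 * x))"
    using Gamma_complex_of_real[of x] Gamma_complex_of_real[of "x + 1/2"] Gamma_complex_of_real[of "2 * x"]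
    by (simp flip: exp_of_real)
  then have "Gamma x * Gamma (x + 1/2) = exp ((1 - 2 * x) * ln 2) * sqrt pi * Gamma (2 * x)"
    by (subst (asm) of_real_eq_iff)
  then show ?thesis by (simp add: powr_def)
qed

text \<open>With M = \<open>airy_M\<close>, the right sides are M(0), -M'(0) and M''(0). The outer
  two identities are reduced to \<open>G1\<close>, \<open>G2\<close> and powers of 2 and 3, where
  duplication at 1/6 and at 1/3 expresses Gamma(1/6) and Gamma(5/6); the middle one needs only
  Gamma(1/2) and \<open>airy_c1_c2\<close>.\<close>

lemma airy_c_J:
  "2 / (pi * sqrt pi) * airy_J 0 0 = 4 * airy_c1\<^sup>2"
  "2 / (pi * sqrt pi) * airy_J 1 0 = 4 * (airy_c1 * airy_c2)"
  "2 / (pi * sqrt pi) * airy_J 2 0 = 8 * airy_c2\<^sup>2"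
proof -
  define G1 G2 where "G1 = Gamma (1/3 :: real)" and "G2 = Gamma (2/3 :: real)"
  have pos: "G1 > 0" "G2 > 0" "sqrt pi > 0" by (auto simp: G1_def G2_def intro: Gamma_real_pos)
  have c: "airy_c1 = 1 / (3 powr (2/3) * G2)" "airy_c2 = 1 / (3 powr (1/3) * G1)"
    by (simp_all add: airy_c1_def airy_c2_def G1_def G2_def)
  \<comment> \<open>Reflection, read backwards from \<open>airy_c1_c2\<close>. It trades the
    remaining factor pi for \<open>G1 * G2\<close>, so that \<open>G1\<close> cancels in the first
    identity and \<open>G2\<close> in the third.\<close>
  have pi: "pi = 3 powr (1/2) / 2 * G1 * G2"
  proof -
    have "3 powr (2/3) * 3 powr (1/3) = (3::real)" by (simp flip: powr_add)
    then have "1 / (3 * (G1 * G2)) = 1 / (2 * sqrt 3 * pi)"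
      using airy_c1_c2 unfolding c by (simp add: mult_ac)
    then have "3 * (G1 * G2) = 2 * sqrt 3 * pi"
      using pos by (simp add: field_simps)
    then have "sqrt 3 * (3 * (G1 * G2)) = 2 * (sqrt 3 * sqrt 3) * pi" by (simp add: mult_ac)
    then have "pi = sqrt 3 / 2 * G1 * G2" by (simp add: mult_ac)
    then show ?thesis by (simp only: powr_half_sqrt zero_le_numeral)
  qed
  have 12: "(12::real) powr x = 3 powr x * 2 powr (2 * x)" for x
  proof -
    have "(12::real) powr x = 3 powr x * 4 powr x" by (simp flip: powr_mult)
    also have "(4::real) powr x = 2 powr (2 * x)" using powr_powr[of 2 2 x] by simp
    finally show ?thesis .
  qed
  have D1: "Gamma (1/6) = 2 powr (2/3) * sqrt pi * G1 / G2"
    using Gamma_duplication_real[of "1/6"] pos by (simp add: G1_def[symmetric] G2_def[symmetric] field_simps)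
  have D2: "Gamma (5/6) = 2 powr (1/3) * sqrt pi * G2 / G1"
    using Gamma_duplication_real[of "1/3"] pos by (simp add: G1_def[symmetric] G2_def[symmetric] field_simps)
  have J0: "airy_J 0 0 = 2 * 12 powr (-5/6) * Gamma (1/6)"
    and J1: "airy_J 1 0 = 2 * 12 powr (-1/2) * sqrt pi"
    and J2: "airy_J 2 0 = 2 * 12 powr (-1/6) * Gamma (5/6)"
    using airy_J_at_0[of 0] airy_J_at_0[of 1] airy_J_at_0[of 2] by (simp_all add: Gamma_one_half_real)
  have "2 / (pi * sqrt pi) * airy_J 0 0 = 4 * (2 powr (-5/3) * 2 powr (2/3)) * 3 powr (-5/6) * G1 / (G2 * pi)"
    unfolding J0 D1 12 using pos by (simp add: field_simps)
  also have "2 powr (-5/3) * 2 powr (2/3) = 1 / (2::real)"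
    unfolding powr_add[symmetric] powr_diff[symmetric] by (simp add: powr_minus_divide)
  also have "4 * (1/2) * 3 powr (-5/6) * G1 / (G2 * pi) = 4 * (3 powr (-5/6) / 3 powr (1/2)) / G2\<^sup>2"
    using pos by (subst pi) (simp add: field_simps power2_eq_square)
  also have "3 powr (-5/6) / 3 powr (1/2) = 1 / (3 powr (2/3) * (3::real) powr (2/3))"
    unfolding powr_add[symmetric] powr_diff[symmetric] by (simp add: powr_minus_divide)
  also have "4 * (1 / (3 powr (2/3) * 3 powr (2/3))) / G2\<^sup>2 = 4 * airy_c1\<^sup>2"
    unfolding c by (simp add: power2_eq_square)
  finally show "2 / (pi * sqrt pi) * airy_J 0 0 = 4 * airy_c1\<^sup>2" .
  have "2 / (pi * sqrt pi) * airy_J 1 0 = 4 * (1 / (3 powr (1/2) * 2)) / pi"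
    unfolding J1 12 using pos by (simp add: powr_minus field_simps)
  also have "\<dots> = 4 * (airy_c1 * airy_c2)"
    unfolding airy_c1_c2 by (simp add: powr_half_sqrt)
  finally show "2 / (pi * sqrt pi) * airy_J 1 0 = 4 * (airy_c1 * airy_c2)" .
  have "2 / (pi * sqrt pi) * airy_J 2 0 = 4 * (2 powr (-1/3) * 2 powr (1/3)) * 3 powr (-1/6) * G2 / (G1 * pi)"
    unfolding J2 D2 12 using pos by (simp add: field_simps)
  also have "2 powr (-1/3) * 2 powr (1/3) = (1::real)"
    by (simp flip: powr_add)
  also have "4 * 1 * 3 powr (-1/6) * G2 / (G1 * pi) = 8 * (3 powr (-1/6) / 3 powr (1/2)) / G1\<^sup>2"
    using pos by (subst pi) (simp add: field_simps power2_eq_square)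
  also have "3 powr (-1/6) / 3 powr (1/2) = 1 / (3 powr (1/3) * (3::real) powr (1/3))"
    unfolding powr_add[symmetric] powr_diff[symmetric] by (simp add: powr_minus_divide)
  also have "8 * (1 / (3 powr (1/3) * 3 powr (1/3))) / G1\<^sup>2 = 8 * airy_c2\<^sup>2"
    unfolding c by (simp add: power2_eq_square)
  finally show "2 / (pi * sqrt pi) * airy_J 2 0 = 8 * airy_c2\<^sup>2" .
qed

text \<open>\<open>M1\<close> and \<open>M2\<close> are the first two derivatives of
  \<open>airy_M\<close>; the term -2 s \<open>airy_M s\<close> in \<open>M2\<close> comes from
  eliminating the second derivatives of Ai(-s) and Bi(-s) by the Airy equation. The difference of
  the two sides then falls under \<open>airy_product_ode_unique\<close>.\<close>

lemma airy_M_eq: "airy_M s = 2 / (pi * sqrt pi) * airy_J 0 s"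
proof -
  obtain A B where ab: "\<And>x. (airy_Ai has_real_derivative A x) (at x)" "\<And>x. (airy_Bi has_real_derivative B x) (at x)"
    "\<And>x. (A has_real_derivative x * airy_Ai x) (at x)" "\<And>x. (B has_real_derivative x * airy_Bi x) (at x)"
    "airy_Ai 0 = airy_c1" "airy_Bi 0 = sqrt 3 * airy_c1"
    "A 0 = - airy_c2" "B 0 = sqrt 3 * airy_c2"
    using airy_Ai_Bi_ode by blast
  define c where "c = 2 / (pi * sqrt pi)"
  define M1 where "M1 s = - 2 * (airy_Ai (- s) * A (- s) + airy_Bi (- s) * B (- s))" for s
  define M2 where "M2 s = 2 * ((A (- s))\<^sup>2 + (B (- s))\<^sup>2) - 2 * s * airy_M s" for s
  note chain = ab(1-4)[THEN DERIV_chain2, of uminus, OF DERIV_minus[OF DERIV_ident]]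
  have dM: "(airy_M has_real_derivative M1 s) (at s)" for s
    unfolding airy_M_def M1_def
    by (rule derivative_eq_intros chain refl)+ (simp add: algebra_simps)
  have dM1: "(M1 has_real_derivative M2 s) (at s)" for s
    unfolding M1_def M2_def airy_M_def
    by (rule derivative_eq_intros chain refl)+ (simp add: algebra_simps power2_eq_square)
  have dM2: "(M2 has_real_derivative - (4 * s * M1 s + 2 * airy_M s)) (at s)" for s
    unfolding M2_def
    by (rule derivative_eq_intros chain dM refl)+ (simp add: M1_def algebra_simps)
  have J: "airy_J (Suc 0) = airy_J 1" "airy_J (Suc 1) = airy_J 2" "airy_J (Suc 2) = airy_J 3"
    by (simp_all add: numeral_eq_Suc)
  note dJ = airy_J_deriv[of 0, unfolded J] airy_J_deriv[of 1, unfolded J] airy_J_deriv[of 2, unfolded J]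
  have "airy_M s - c * airy_J 0 s = 0"
  proof (rule airy_product_ode_unique[where y = "\<lambda>s. airy_M s - c * airy_J 0 s" and y' = "\<lambda>s. M1 s + c * airy_J 1 s" and y'' = "\<lambda>s. M2 s - c * airy_J 2 s"])
    show "((\<lambda>s. airy_M s - c * airy_J 0 s) has_real_derivative M1 s + c * airy_J 1 s) (at s)" for s
      by (rule derivative_eq_intros dM dJ refl)+ simp
    show "((\<lambda>s. M1 s + c * airy_J 1 s) has_real_derivative M2 s - c * airy_J 2 s) (at s)" for s
      by (rule derivative_eq_intros dM1 dJ refl)+ simp
    show "((\<lambda>s. M2 s - c * airy_J 2 s) has_real_derivative
      - (4 * s * (M1 s + c * airy_J 1 s) + 2 * (airy_M s - c * airy_J 0 s))) (at s)" for s
      by (rule derivative_eq_intros dM2 dJ refl)+ (simp add: airy_J_recurrence algebra_simps)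
  qed (simp_all only: c_def airy_c_J, simp_all add: airy_M_def M1_def M2_def ab power2_eq_square algebra_simps)
  then show ?thesis by (simp add: c_def)
qed

subsection \<open>The phase function\<close>

lemma airy_M_pos: "airy_M s > 0"
  unfolding airy_M_eq using airy_J_pos by simp

lemma airy_wronskian:
  assumes A: "\<And>x. (airy_Ai has_real_derivative A x) (at x)" "\<And>x. (A has_real_derivative x * airy_Ai x) (at x)"
    and B: "\<And>x. (airy_Bi has_real_derivative B x) (at x)" "\<And>x. (B has_real_derivative x * airy_Bi x) (at x)"
    and init: "airy_Ai 0 = airy_c1" "airy_Bi 0 = sqrt 3 * airy_c1" "A 0 = - airy_c2" "B 0 = sqrt 3 * airy_c2"
  shows "airy_Ai x * B x - A x * airy_Bi x = 1 / pi"
proof -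
  have "airy_Ai x * B x - A x * airy_Bi x = airy_Ai 0 * B 0 - A 0 * airy_Bi 0"
    by (rule DERIV_isconst_all) (auto intro!: derivative_eq_intros A B)
  also have "\<dots> = 2 * sqrt 3 * (airy_c1 * airy_c2)" by (simp add: init algebra_simps)
  finally show ?thesis by (simp add: airy_c1_c2)
qed

text \<open>The difference is continuous with values in the discrete set 2 pi Z, hence constant, and
  two values in the half-open interval (-pi, pi] differ by less than 2 pi. This gives the uniqueness
  that the definite description in \<open>gam\<close> requires.\<close>

lemma continuous_phase_unique:
  fixes f g :: "real \<Rightarrow> real"
  assumes cont: "continuous_on UNIV f" "continuous_on UNIV g"
    and eq: "\<And>x. exp (\<i> * complex_of_real (f x)) = exp (\<i> * complex_of_real (g x))"
    and init: "- pi < f x0" "f x0 \<le> pi" "- pi < g x0" "g x0 \<le> pi"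
  shows "f = g"
proof
  fix x
  have ex: "\<exists>n::int. f x - g x = 2 * pi * n" for x
  proof -
    obtain n :: int where "\<i> * complex_of_real (f x) = \<i> * complex_of_real (g x) + of_int (2 * n) * pi * \<i>"
      using eq[of x] unfolding exp_eq by blast
    then have "Im (\<i> * complex_of_real (f x)) = Im (\<i> * complex_of_real (g x) + of_int (2 * n) * pi * \<i>)"
      by (simp only:)
    then have "f x - g x = 2 * pi * n" by simp
    then show ?thesis by blast
  qed
  have "(\<lambda>x. f x - g x) constant_on UNIV"
  proof (rule continuous_discrete_range_constant)
    show "continuous_on UNIV (\<lambda>x. f x - g x)" by (intro continuous_intros cont)
    fix x :: real
    have "2 * pi \<le> norm (f y - g y - (f x - g x))" if ne: "f y - g y \<noteq> f x - g x" for y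
    proof -
      obtain m n :: int where mn: "f y - g y = 2 * pi * m" "f x - g x = 2 * pi * n"
        using ex by metis
      then have "m \<noteq> n" using ne by auto
      then have "1 \<le> \<bar>real_of_int (m - n)\<bar>" by linarith
      then have "2 * pi * 1 \<le> 2 * pi * \<bar>real_of_int (m - n)\<bar>" by (intro mult_left_mono) auto
      also have "\<dots> = norm (2 * pi * m - 2 * pi * n)"
        by (simp add: abs_mult flip: right_diff_distrib)
      finally show ?thesis unfolding mn by simp
    qed
    then show "\<exists>e>0. \<forall>y. y \<in> UNIV \<and> f y - g y \<noteq> f x - g x \<longrightarrow> e \<le> norm (f y - g y - (f x - g x))"
      using pi_gt_zero by (intro exI[of _ "2 * pi"]) auto
  qed auto
  then obtain c where "f x - g x = c" for x by (auto simp: constant_on_def)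
  then have "f x - g x = f x0 - g x0" by simp
  moreover obtain n :: int where n: "f x0 - g x0 = 2 * pi * n" using ex by blast
  have "\<bar>2 * pi * n\<bar> < 2 * pi" using init unfolding n[symmetric] by linarith
  then have "\<bar>real_of_int n\<bar> < 1" by (simp add: abs_mult)
  then have "n = 0" by linarith
  ultimately show "f x = g x" using n by simp
qed

text \<open>L is an antiderivative of z'/z, and z exp(-L) has derivative 0; branch cuts never enter.
  The principal logarithm is used only at 0, where it puts the imaginary part into (-pi, pi], as the
  normalisation in \<open>gam\<close> demands.\<close>

lemma differentiable_logarithm_exists:
  fixes z z' :: "real \<Rightarrow> complex"
  assumes d: "\<And>x. (z has_vector_derivative z' x) (at x)"
    and cont: "\<And>x. isCont z' x" and nz: "\<And>x. z x \<noteq> 0"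
  shows "\<exists>L. (\<forall>x. z x = exp (L x)) \<and> (\<forall>x. (L has_vector_derivative z' x / z x) (at x)) \<and> L 0 = Ln (z 0)"
proof -
  have "isCont z x" for x by (rule has_vector_derivative_continuous[OF d])
  then have "isCont (\<lambda>x. z' x / z x) x" for x
    by (intro continuous_intros cont nz)
  then obtain L0 where "\<And>x. (L0 has_vector_derivative z' x / z x) (at x)"
    using einterval_antiderivative[of "-\<infinity>" \<infinity> "\<lambda>x. z' x / z x"] by auto
  then have dL: "((\<lambda>x. L0 x + (Ln (z 0) - L0 0)) has_vector_derivative z' x / z x) (at x)" for x
    by (auto intro!: derivative_eq_intros)
  define L where "L = (\<lambda>x. L0 x + (Ln (z 0) - L0 0))"
  note dL = dL[folded L_def]
  have L0: "L 0 = Ln (z 0)" by (simp add: L_def)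
  have dE: "((\<lambda>x. exp (- L x)) has_vector_derivative - (z' x / z x) * exp (- L x)) (at x)" for x
    using field_vector_diff_chain_at[OF has_vector_derivative_minus[OF dL] DERIV_exp]
    by (simp add: o_def mult.commute)
  have "((\<lambda>x. z x * exp (- L x)) has_vector_derivative 0) (at x)" for x
    using has_vector_derivative_mult[OF d dE, of x] nz[of x] by simp
  then obtain c where c: "\<And>x. z x * exp (- L x) = c"
    using has_vector_derivative_zero_constant[of UNIV "\<lambda>x. z x * exp (- L x)"] by auto
  have "c = 1" using c[of 0] nz[of 0] by (simp add: L0 exp_minus exp_Ln)
  then have "z x = exp (L x)" for x using c[of x] by (simp add: exp_minus field_simps)
  then show ?thesis using dL L0 by blast
qed

text \<open>The parameter-free phase derivative, in the variable s = F^(1/3) (x + E/F).\<close>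

definition airy_phase_deriv :: "real \<Rightarrow> real" where
  "airy_phase_deriv s = 1 / (pi * airy_M s)"

text \<open>The phase is the imaginary part of a logarithm, so its derivative is Im (z' cnj z) /
  |z|^2. The numerator is k c^2 times the Wronskian 1/pi, and c^2 = pi/k, which comes from the
  prefactor of \<open>zeta\<close>, makes it exactly 1. Existence and uniqueness of the phase then
  identify it with \<open>gam\<close>.\<close>

lemma gam_has_derivative:
  assumes F: "F > 0"
  shows "(gam E F has_real_derivative
            F powr (1/3) * airy_phase_deriv (F powr (1/3) * (x + E / F))) (at x)"
proof -
  obtain A B where ab: "\<And>x. (airy_Ai has_real_derivative A x) (at x)" "\<And>x. (airy_Bi has_real_derivative B x) (at x)"
    "\<And>x. (A has_real_derivative x * airy_Ai x) (at x)" "\<And>x. (B has_real_derivative x * airy_Bi x) (at x)"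
    "airy_Ai 0 = airy_c1" "airy_Bi 0 = sqrt 3 * airy_c1"
    "A 0 = - airy_c2" "B 0 = sqrt 3 * airy_c2"
    using airy_Ai_Bi_ode by blast
  define k where "k = F powr (1/3)"
  have k: "k > 0" using F by (simp add: k_def)
  define t where "t x = - k * (x + E / F)" for x
  have dt: "(t has_real_derivative - k) (at x)" for x
    unfolding t_def by (auto intro!: derivative_eq_intros)
  define c where "c = sqrt (pi / k)"
  have c: "c > 0" "c\<^sup>2 = pi / k" using k by (simp_all add: c_def)
  define z where "z x = zeta E F x" for x
  have z: "z x = Complex (c * airy_Bi (t x)) (c * airy_Ai (t x))" for x
    by (simp add: z_def zeta_def c_def t_def k_def complex_eq_iff)
  define z' where "z' x = Complex (- k * c * B (t x)) (- k * c * A (t x))" for x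
  have z_alt: "z = (\<lambda>x. complex_of_real (c * airy_Bi (t x)) + \<i> * complex_of_real (c * airy_Ai (t x)))"
    by (auto simp: z complex_eq_iff)
  have dz: "(z has_vector_derivative z' x) (at x)" for x
  proof -
    have a: "((\<lambda>x. c * airy_Bi (t x)) has_real_derivative - k * c * B (t x)) (at x)"
        "((\<lambda>x. c * airy_Ai (t x)) has_real_derivative - k * c * A (t x)) (at x)"
      using DERIV_cmult[OF DERIV_chain2[OF ab(2) dt], of c x] DERIV_cmult[OF DERIV_chain2[OF ab(1) dt], of c x]
      by (simp_all add: mult.commute mult.left_commute)
    have "(z has_vector_derivative
        (complex_of_real (- k * c * B (t x)) + \<i> * complex_of_real (- k * c * A (t x)))) (at x)"
      unfolding z_alt
      by (intro has_vector_derivative_add has_vector_derivative_mult_right has_vector_derivative_of_real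
a)
    then show ?thesis unfolding z'_def by (simp add: complex_eq_iff Complex_eq)
  qed
  have "isCont z' x" for x
  proof -
    have "isCont A x" "isCont B x" "isCont t x" for x
      using ab(3,4) dt DERIV_isCont by blast+
    then have "isCont (\<lambda>x. A (t x)) x" "isCont (\<lambda>x. B (t x)) x"
      by (auto intro: continuous_within_compose3)
    then show ?thesis unfolding z'_def Complex_eq
      by (intro continuous_intros)
  qed
  have norm_z: "(cmod (z x))\<^sup>2 = pi / k * airy_M (- t x)" for x
    by (simp add: z cmod_power2 airy_M_def c(2)[symmetric] algebra_simps power_mult_distrib)
  have nz: "z x \<noteq> 0" for x
    using norm_z[of x] airy_M_pos[of "- t x"] k by auto
  obtain L where L: "\<And>x. z x = exp (L x)" "\<And>x. (L has_vector_derivative z' x / z x) (at x)" "L 0 = Ln (z 0)"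
    using differentiable_logarithm_exists[OF dz \<open>\<And>x. isCont z' x\<close> nz] by blast
  define g where "g x = Im (L x)" for x
  have Im: "Im (z' x / z x) = k * airy_phase_deriv (k * (x + E / F))" for x
  proof -
    have "Im (z' x / z x) = Im (z' x * cnj (z x)) / (cmod (z x))\<^sup>2"
      by (simp add: complex_div_cnj[of "z' x"] Im_divide_of_real flip: of_real_power)
    also have "Im (z' x * cnj (z x)) = k * c\<^sup>2 * (airy_Ai (t x) * B (t x) - A (t x) * airy_Bi (t x))"
      by (simp add: z z'_def algebra_simps power2_eq_square)
    also have "\<dots> = 1"
      using k by (simp add: airy_wronskian[OF ab(1,3,2,4,5-8)] c(2))
    finally show ?thesis using k by (simp add: norm_z airy_phase_deriv_def t_def)
  qed
  have dg: "(g has_real_derivative k * airy_phase_deriv (k * (x + E / F))) (at x)" for x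
    using bounded_linear.has_vector_derivative[OF bounded_linear_Im L(2)[of x]] unfolding Im g_def
    by (simp add: has_real_derivative_iff_has_vector_derivative)
  have contg: "continuous_on UNIV g"
    using dg by (meson DERIV_isCont continuous_at_imp_continuous_on)
  have zg: "z x = complex_of_real (cmod (z x)) * exp (\<i> * complex_of_real (g x))" for x
    unfolding L(1)[of x] g_def norm_exp_eq_Re cis_conv_exp[symmetric] by (rule exp_eq_polar)
  have g0: "- pi < g 0" "g 0 \<le> pi"
    using nz[of 0] mpi_less_Im_Ln Im_Ln_le_pi by (auto simp: g_def L(3))
  have "gam E F = g"
    unfolding gam_def
  proof (rule the_equality)
    show "continuous_on UNIV g \<and>
      (\<forall>x. zeta E F x = complex_of_real (cmod (zeta E F x)) * exp (\<i> * complex_of_real (g x))) \<and>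
      - pi < g 0 \<and> g 0 \<le> pi"
      using contg zg g0 by (simp add: z_def)
  next
    fix f assume f: "continuous_on UNIV f \<and>
      (\<forall>x. zeta E F x = complex_of_real (cmod (zeta E F x)) * exp (\<i> * complex_of_real (f x))) \<and>
      - pi < f 0 \<and> f 0 \<le> pi"
    show "f = g"
    proof (rule continuous_phase_unique)
      fix x
      have "complex_of_real (cmod (z x)) * exp (\<i> * complex_of_real (f x))
          = complex_of_real (cmod (z x)) * exp (\<i> * complex_of_real (g x))"
        using f zg[of x] by (metis z_def)
      then show "exp (\<i> * complex_of_real (f x)) = exp (\<i> * complex_of_real (g x))"
        using nz[of x] by simp
    qed (use f contg g0 in auto)
  qed
  then show ?thesis using dg by (simp add: k_def)
qed

section \<open>Growth of the phase derivative and position of the points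
  \<open>Xl E F l\<close>\<close>

text \<open>The phase derivative is d / \<open>airy_J 0\<close>, so its own derivative is d
  \<open>airy_J 1\<close> / (\<open>airy_J 0\<close>)^2, a quotient of positive integrals. The
  orders follow from those of the moments: s^(-1/2) for \<open>airy_J 0\<close>, and at least
  s^(-3/2) for \<open>airy_J 1\<close>.\<close>

lemma airy_phase_deriv_bounds:
  obtains p' c where "c > 0"
    "\<And>s. (airy_phase_deriv has_real_derivative p' s) (at s)" "\<And>s. p' s > 0"
    "\<And>s. s \<ge> 1 \<Longrightarrow> c * sqrt s \<le> airy_phase_deriv s"
    "\<And>s. s \<ge> 1 \<Longrightarrow> airy_phase_deriv s \<le> sqrt s / c"
    "\<And>s. s \<ge> 1 \<Longrightarrow> c / sqrt s \<le> p' s"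
proof -
  define d where "d = sqrt pi / 2"
  have d: "d > 0" by (simp add: d_def)
  have p: "airy_phase_deriv = (\<lambda>s. d / airy_J 0 s)"
    by (rule ext) (simp add: airy_phase_deriv_def airy_M_eq d_def)
  define p' where "p' s = d * airy_J 1 s / (airy_J 0 s)\<^sup>2" for s
  define e where "e = exp (- 13 / 12 :: real)"
  have e: "e > 0" "e \<le> 1" by (auto simp: e_def)
  \<comment> \<open>\<open>c1\<close> stems from the upper bound for \<open>airy_J 0\<close>,
    \<open>c2\<close> from its lower bound, and \<open>c3\<close> from the lower bound for
    \<open>airy_J 1\<close> over the square of the upper bound for \<open>airy_J 0\<close>.\<close>
  define c1 where "c1 = 2 * d / exp 1"
  define c2 where "c2 = e / d"
  define c3 where "c3 = 4 * d * (e / 3) / (exp 1)\<^sup>2"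
  define c where "c = min c1 (min c2 c3)"
  have c: "c > 0" "c \<le> c1" "c \<le> c2" "c \<le> c3"
    using d e by (auto simp: c_def c1_def c2_def c3_def)
  show ?thesis
  proof (rule that[of c p'])
    show "c > 0" by fact
    show "(airy_phase_deriv has_real_derivative p' s) (at s)" for s
      using airy_J_pos[of 0 s] unfolding p p'_def
      by (auto intro!: derivative_eq_intros airy_J_deriv simp: power2_eq_square)
    show "p' s > 0" for s
      unfolding p'_def using d airy_J_pos[of 0 s] airy_J_pos[of 1 s] by simp
    fix s :: real assume s: "s \<ge> 1"
    then have s0: "sqrt s > 0" by simp
    note J0 = airy_J_pos[of 0 s]
    have up: "airy_J 0 s \<le> exp 1 / (2 * sqrt s)" using s by (intro airy_J_upper) auto
    have "c * sqrt s \<le> c1 * sqrt s" using c s0 by simp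
    also have "\<dots> = d / (exp 1 / (2 * sqrt s))" by (simp add: c1_def)
    also have "\<dots> \<le> d / airy_J 0 s" using d J0 up s0 by (intro divide_left_mono mult_pos_pos) auto
    finally show "c * sqrt s \<le> airy_phase_deriv s" by (simp add: p)
    have lo: "e / sqrt s \<le> airy_J 0 s" using airy_J_lower[OF s, of 0] by (simp add: e_def)
    have "d / airy_J 0 s \<le> d / (e / sqrt s)" using d e s0 lo J0 by (intro divide_left_mono mult_pos_pos divide_pos_pos) auto
    also have "\<dots> = sqrt s / c2" by (simp add: c2_def)
    also have "\<dots> \<le> sqrt s / c" using c s0 by (intro divide_left_mono) auto
    finally show "airy_phase_deriv s \<le> sqrt s / c" by (simp add: p)
    have lo1: "e / 3 / sqrt s ^ 3 \<le> airy_J 1 s"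
      using airy_J_lower[OF s, of 1] by (simp add: e_def power_divide numeral_3_eq_3)
    have "c / sqrt s \<le> c3 / sqrt s" using c s0 by (intro divide_right_mono) auto
    also have "\<dots> = d * (e / 3 / sqrt s ^ 3) / (exp 1 / (2 * sqrt s))\<^sup>2"
      using s0 by (simp add: c3_def field_simps power2_eq_square power3_eq_cube)
    also have "\<dots> \<le> d * airy_J 1 s / (airy_J 0 s)\<^sup>2"
      using d e s0 lo1 J0 up less_imp_le[OF airy_J_pos[of 1 s]] by (intro frac_le mult_left_mono mult_nonneg_nonneg power_mono) auto
    finally show "c / sqrt s \<le> p' s" by (simp add: p'_def)
  qed
qed

lemma deriv_gam:
  "F > 0 \<Longrightarrow> deriv (gam E F) x = F powr (1/3) * airy_phase_deriv (F powr (1/3) * (x + E / F))"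
  by (rule DERIV_imp_deriv[OF gam_has_derivative])

lemma airy_phase_deriv_strict_mono: "strict_mono airy_phase_deriv"
proof -
  obtain p' where p': "\<And>s. (airy_phase_deriv has_real_derivative p' s) (at s)" "\<And>s. p' s > 0"
    by (rule airy_phase_deriv_bounds) (rule that)
  show ?thesis
    by (rule strict_monoI, rule DERIV_pos_imp_increasing) (use p' in blast)+
qed

lemma deriv_gam_strict_mono: "F > 0 \<Longrightarrow> strict_mono (deriv (gam E F))"
  using airy_phase_deriv_strict_mono by (auto simp: strict_mono_def deriv_gam)

text \<open>Write k = F^(1/3) and p = \<open>airy_phase_deriv\<close>. In the variable s the
  equation for \<open>Xl E F l\<close> reads p(s) = pi l / k, so sqrt s has order l and the solution
  itself order l^2. The second derivative of the phase is k^2 p'(s), hence at least a constant over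
  sqrt s, that is, over l.\<close>

lemma Xl_regularity:
  fixes F0 F1 E1 :: real
  assumes F0: "F0 > 0"
  obtains c L0 where "0 < c" "c \<le> 1"
    "\<And>E F l. F0 \<le> F \<Longrightarrow> F \<le> F1 \<Longrightarrow> \<bar>E\<bar> \<le> E1 \<Longrightarrow> L0 \<le> l \<Longrightarrow> deriv (gam E F) (Xl E F l) = pi * real l"
    "\<And>E F l. F0 \<le> F \<Longrightarrow> F \<le> F1 \<Longrightarrow> \<bar>E\<bar> \<le> E1 \<Longrightarrow> L0 \<le> l \<Longrightarrow> c * (real l)\<^sup>2 \<le> Xl E F l"
    "\<And>E F l x y. F0 \<le> F \<Longrightarrow> F \<le> F1 \<Longrightarrow> \<bar>E\<bar> \<le> E1 \<Longrightarrow> L0 \<le> l \<Longrightarrow>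
       Xl E F l \<le> x \<Longrightarrow> x \<le> y \<Longrightarrow> y \<le> Xl E F (l + 1) \<Longrightarrow>
       c / real l * (y - x) \<le> deriv (gam E F) y - deriv (gam E F) x"
proof -
  obtain p' b where b: "b > 0"
    and p': "\<And>s. (airy_phase_deriv has_real_derivative p' s) (at s)" "\<And>s. p' s > 0"
    and bd: "\<And>s. s \<ge> 1 \<Longrightarrow> b * sqrt s \<le> airy_phase_deriv s"
      "\<And>s. s \<ge> 1 \<Longrightarrow> airy_phase_deriv s \<le> sqrt s / b"
      "\<And>s. s \<ge> 1 \<Longrightarrow> b / sqrt s \<le> p' s"
    by (rule airy_phase_deriv_bounds) (rule that)
  \<comment> \<open>From sqrt s \<ge> pi l b / k one gets s/k \<ge> b^2 pi^2 l^2 / k^3, and k^3 = F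
    \<le> F1 gives \<open>d\<close>. Half of it is given up below to absorb the shift E/F. The 2 in
    F0 b^2 / (2 pi) comes from l + 1 \<le> 2 l. If F1 \<le> 0, no F is admissible and the value 1
    just keeps \<open>c\<close> positive.\<close>
  define d where "d = b\<^sup>2 * pi\<^sup>2 / F1"
  define c where "c = min 1 (min (F0 * b\<^sup>2 / (2 * pi)) (if F1 > 0 then d / 2 else 1))"
  \<comment> \<open>The first entry forces p(1) \<le> pi l / k, so that the solution lies in s \<ge>
    1, where the growth bounds hold; the second forces E1/F0 \<le> (d/2) l.\<close>
  define L0 where "L0 = max 1 (nat \<lceil>max (max 1 F1 powr (1/3) * airy_phase_deriv 1 / pi) (2 * E1 / (F0 * d))\<rceil>)"
  have c: "0 < c" "c \<le> 1" "c \<le> F0 * b\<^sup>2 / (2 * pi)" and cd: "F1 > 0 \<Longrightarrow> c \<le> d / 2"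
    using F0 b by (auto simp: c_def d_def)
  have main: "deriv (gam E F) (Xl E F l) = pi * real l"
      "F powr (1/3) * (Xl E F l + E / F) \<ge> 1"
      "b * sqrt (F powr (1/3) * (Xl E F l + E / F)) \<le> pi * l / F powr (1/3)"
      "pi * l / F powr (1/3) \<le> sqrt (F powr (1/3) * (Xl E F l + E / F)) / b"
    if F: "F0 \<le> F" "F \<le> F1" and l: "L0 \<le> l" for E F l
  proof -
    define k where "k = F powr (1/3)"
    have k: "k > 0" using F F0 by (simp add: k_def)
    define v where "v = pi * l / k"
    have p1: "airy_phase_deriv 1 > 0" using bd(1)[of 1] b by simp
    have "k \<le> max 1 F1 powr (1/3)" unfolding k_def using F F0 by (intro powr_mono2) auto
    then have "k * airy_phase_deriv 1 / pi \<le> max 1 F1 powr (1/3) * airy_phase_deriv 1 / pi"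
      using p1 by (intro divide_right_mono mult_right_mono) auto
    also have "\<dots> \<le> l" using l unfolding L0_def by linarith
    finally have v1: "airy_phase_deriv 1 \<le> v" using k by (simp add: v_def field_simps)
    \<comment> \<open>Chosen so that b sqrt S \<ge> v, hence p(S) \<ge> v: the right end for the
      intermediate value theorem.\<close>
    define S where "S = max 1 ((v / b)\<^sup>2)"
    have "v \<le> b * sqrt S"
    proof -
      have "v / b \<le> sqrt S" by (rule real_le_rsqrt) (simp add: S_def)
      then show ?thesis using b by (simp add: field_simps)
    qed
    also have "\<dots> \<le> airy_phase_deriv S" by (rule bd(1)) (simp add: S_def)
    finally obtain s where s: "1 \<le> s" "airy_phase_deriv s = v"
      using IVT[of airy_phase_deriv 1 v S] v1 DERIV_isCont[OF p'(1)] by (auto simp: S_def)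
    define x where "x = s / k - E / F"
    have sx: "s = k * (x + E / F)" using k by (simp add: x_def)
    have x: "deriv (gam E F) x = pi * l"
      using F F0 k s by (simp add: deriv_gam v_def flip: sx k_def)
    have "Xl E F l = x"
      unfolding Xl_def
    proof (rule the_equality)
      show "deriv (gam E F) x = pi * real l" by (rule x)
      show "y = x" if "deriv (gam E F) y = pi * real l" for y
        using strict_mono_eq[OF deriv_gam_strict_mono, of F E y x] that x F F0 by simp
    qed
    then show "deriv (gam E F) (Xl E F l) = pi * real l"
      "F powr (1/3) * (Xl E F l + E / F) \<ge> 1"
      "b * sqrt (F powr (1/3) * (Xl E F l + E / F)) \<le> pi * l / F powr (1/3)"
      "pi * l / F powr (1/3) \<le> sqrt (F powr (1/3) * (Xl E F l + E / F)) / b"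
      using x s bd(1,2)[of s] by (simp_all add: v_def flip: k_def sx)
  qed
  show ?thesis
  proof (rule that[of c L0])
    show "0 < c" "c \<le> 1" by fact+
  next
    fix E F :: real and l :: nat
    assume F: "F0 \<le> F" "F \<le> F1" and E: "\<bar>E\<bar> \<le> E1" and l: "L0 \<le> l"
    then show "deriv (gam E F) (Xl E F l) = pi * real l" by (intro main)
    define k where "k = F powr (1/3)"
    have k: "k > 0" "k ^ 3 = F" using F F0 by (auto simp: k_def powr_powr simp flip: powr_realpow)
    define s where "s = k * (Xl E F l + E / F)"
    have s: "1 \<le> s" "pi * l / k \<le> sqrt s / b"
      using main(2,4)[OF F l, of E] by (simp_all add: s_def k_def)
    have "(pi * l / k * b)\<^sup>2 \<le> (sqrt s)\<^sup>2"
      using s b k by (intro power_mono) (auto simp: field_simps)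
    then have "(pi * l / k * b)\<^sup>2 / k \<le> s / k" using s k by (intro divide_right_mono) auto
    moreover have "(pi * l / k * b)\<^sup>2 / k = b\<^sup>2 * pi\<^sup>2 / F * (real l)\<^sup>2"
      by (simp add: power2_eq_square power3_eq_cube flip: k(2))
    moreover have "d * (real l)\<^sup>2 \<le> b\<^sup>2 * pi\<^sup>2 / F * (real l)\<^sup>2"
      unfolding d_def using F F0 by (intro mult_right_mono divide_left_mono) auto
    moreover have "s / k = Xl E F l + E / F" using k by (simp add: s_def)
    moreover have "E / F \<le> d / 2 * (real l)\<^sup>2"
    proof -
      have d: "d > 0" using F F0 b by (auto simp: d_def)
      have "E / F \<le> E1 / F0" using E F F0 by (intro frac_le) auto
      also have "2 * E1 / (F0 * d) \<le> l" using l unfolding L0_def by linarith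
      then have "E1 / F0 \<le> d / 2 * l" using F0 d by (simp add: field_simps)
      also have "\<dots> \<le> d / 2 * (real l)\<^sup>2"
        using d l by (intro mult_left_mono) (auto simp: power2_eq_square L0_def)
      finally show ?thesis .
    qed
    moreover have "c * (real l)\<^sup>2 \<le> d / 2 * (real l)\<^sup>2" using cd F F0 by (intro mult_right_mono) auto
    moreover have "d * (real l)\<^sup>2 = d / 2 * (real l)\<^sup>2 + d / 2 * (real l)\<^sup>2" by simp
    ultimately show "c * (real l)\<^sup>2 \<le> Xl E F l" by linarith
  next
    fix E F x y :: real and l :: nat
    assume F: "F0 \<le> F" "F \<le> F1" and E: "\<bar>E\<bar> \<le> E1" and l: "L0 \<le> l"
      and xy: "Xl E F l \<le> x" "x \<le> y" "y \<le> Xl E F (l + 1)"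
    define k where "k = F powr (1/3)"
    have k: "k > 0" "k ^ 3 = F" using F F0 by (auto simp: k_def powr_powr simp flip: powr_realpow)
    have l1: "l \<ge> 1" using l by (simp add: L0_def)
    \<comment> \<open>Subtracting the linear function turns the claim on increments into
      monotonicity of \<open>D\<close>, and so into the pointwise bound c/l for the second
      derivative of the phase.\<close>
    define D where "D t = k * airy_phase_deriv (k * (t + E / F)) - c / real l * t" for t
    have D: "(D has_real_derivative k * (p' (k * (t + E / F)) * k) - c / real l) (at t)" for t
      unfolding D_def by (rule derivative_eq_intros DERIV_chain2[OF p'(1)] refl)+ simp
    have "D x \<le> D y"
    proof (rule DERIV_nonneg_imp_nondecreasing[OF xy(2)])
      fix t assume t: "x \<le> t" "t \<le> y"
      define s where "s = k * (t + E / F)"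
      have "k * (Xl E F l + E / F) \<le> s" "s \<le> k * (Xl E F (l + 1) + E / F)"
        unfolding s_def using k t xy by (auto intro!: mult_left_mono)
      then have s1: "s \<ge> 1" and s2: "b * sqrt s \<le> b * sqrt (k * (Xl E F (l + 1) + E / F))"
        using main(2)[OF F l, of E] b by (auto simp: k_def)
      note s2
      also have "\<dots> \<le> pi * (l + 1) / k"
        using main(3)[OF F, of "l + 1" E] l by (simp add: k_def)
      also have "\<dots> \<le> pi * (2 * l) / k"
        using l1 k by (intro divide_right_mono mult_left_mono) auto
      finally have "b * sqrt s \<le> 2 * pi * l / k" by (simp add: mult_ac)
      then have "k * b * (sqrt s * b) \<le> k * b * (2 * pi * l / k)"
        using k b by (intro mult_left_mono) (auto simp: mult.commute)
      then have sq: "k * b\<^sup>2 * sqrt s \<le> 2 * pi * l * b" using k by (simp add: power2_eq_square mult_ac)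
      have "c / l \<le> F0 * b\<^sup>2 / (2 * pi) / l" using c by (intro divide_right_mono) auto
      also have "\<dots> \<le> F * b\<^sup>2 / (2 * pi) / l" using F by (intro divide_right_mono mult_right_mono) auto
      also have "\<dots> = k\<^sup>2 * (k * b\<^sup>2 / (2 * pi * l))"
        by (simp add: power2_eq_square power3_eq_cube flip: k(2))
      also have "k * b\<^sup>2 / (2 * pi * l) \<le> b / sqrt s"
        using sq s1 l1 by (simp add: field_simps)
      also have "b / sqrt s \<le> p' s" by (rule bd(3)[OF s1])
      finally have "c / l \<le> k * (p' s * k)" using k by (simp add: power2_eq_square mult_ac)
      then show "\<exists>z. (D has_real_derivative z) (at t) \<and> 0 \<le> z"
        using D[of t] by (auto simp: s_def)
    qed
    then show "c / real l * (y - x) \<le> deriv (gam E F) y - deriv (gam E F) x"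
      using F F0 by (simp add: D_def deriv_gam k_def right_diff_distrib)
  qed
qed

subsection \<open>Exponential sums\<close>

text \<open>Abel summation against the partial sums of z. It serves twice: in the Kusmin--Landau
  inequality, where those partial sums telescope, and for inserting the weight and the
  twist.\<close>

lemma norm_sum_mult_le_variation:
  fixes g z :: "nat \<Rightarrow> 'a :: real_normed_field"
  assumes mn: "m \<le> n"
    and P: "\<And>j. m \<le> j \<Longrightarrow> j \<le> n \<Longrightarrow> norm (\<Sum>k=m..j. z k) \<le> P"
  shows "norm (\<Sum>k=m..n. g k * z k) \<le> P * (norm (g n) + (\<Sum>k=m..<n. norm (g (Suc k) - g k)))"
proof -
  define Z where "Z j = (\<Sum>k=m..j. z k)" for j
  have "(\<Sum>k=m..n. g k * z k) = g n * Z n - (\<Sum>k=m..<n. (g (Suc k) - g k) * Z k)"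
    using mn
  proof (induction n rule: dec_induct)
    case (step n)
    then show ?case by (simp add: Z_def sum.nat_ivl_Suc' algebra_simps)
  qed (simp add: Z_def)
  also have "norm \<dots> \<le> norm (g n * Z n) + (\<Sum>k=m..<n. norm ((g (Suc k) - g k) * Z k))"
    by (intro order_trans[OF norm_triangle_ineq4] add_left_mono norm_sum)
  also have "\<dots> \<le> norm (g n) * P + (\<Sum>k=m..<n. norm (g (Suc k) - g k) * P)"
    unfolding norm_mult using P mn
    by (intro add_mono sum_mono mult_left_mono) (auto simp: Z_def)
  finally show ?thesis by (simp add: sum_distrib_left algebra_simps)
qed

lemma cot_le_inverse:
  fixes x :: real
  assumes "0 < x" "x < pi"
  shows "cot x \<le> 1 / x"
proof -
  have "(\<lambda>t. sin t - t * cos t) 0 \<le> (\<lambda>t. sin t - t * cos t) x"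
  proof (rule DERIV_nonneg_imp_nondecreasing[of 0 x "\<lambda>t. sin t - t * cos t"])
    fix t assume "0 \<le> t" "t \<le> x"
    then show "\<exists>y. ((\<lambda>t. sin t - t * cos t) has_real_derivative y) (at t) \<and> 0 \<le> y"
      using assms sin_ge_zero[of t]
      by (intro exI[of _ "t * sin t"] conjI) (auto intro!: derivative_eq_intros mult_nonneg_nonneg)
  qed (use assms in auto)
  then show ?thesis
    using assms sin_gt_zero[of x] by (simp add: cot_def field_simps)
qed

lemma cot_mono_decreasing:
  fixes x y :: real
  assumes "0 < x" "x \<le> y" "y < pi"
  shows "cot y \<le> cot x"
proof -
  have "sin x > 0" "sin y > 0" "sin (y - x) \<ge> 0"
    using assms by (auto intro!: sin_gt_zero sin_ge_zero)
  then have "cot x - cot y = sin (y - x) / (sin x * sin y)"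
    by (simp add: cot_def sin_diff field_simps)
  also have "\<dots> \<ge> 0" using \<open>sin x > 0\<close> \<open>sin y > 0\<close> \<open>sin (y - x) \<ge> 0\<close> by simp
  finally show ?thesis by simp
qed

text \<open>The Kusmin--Landau inequality: each term is a multiple of a forward difference:
  \<open>z\<^sub>k = (z\<^sub>k\<^sub>+\<^sub>1 - z\<^sub>k) / (cis \<theta> - 1)\<close>, where \<open>1 / (cis \<theta> - 1) = - 1 / 2 - (\<i> / 2) cot (\<theta> / 2)\<close> varies
  monotonically along the sum.\<close>

lemma kusmin_landau:
  fixes \<phi> \<theta> :: "nat \<Rightarrow> real"
  assumes mn: "m \<le> n" and \<delta>: "\<delta> > 0"
    and \<theta>: "\<And>k. m \<le> k \<Longrightarrow> k < n \<Longrightarrow> cis (\<phi> (Suc k)) = cis (\<phi> k) * cis (\<theta> k)"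
    and bnd: "\<And>k. m \<le> k \<Longrightarrow> k < n \<Longrightarrow> \<delta> \<le> \<theta> k \<and> \<theta> k \<le> 2 * pi - \<delta>"
    and mono: "\<And>k. m \<le> k \<Longrightarrow> Suc k < n \<Longrightarrow> \<theta> k \<le> \<theta> (Suc k)"
  shows "cmod (\<Sum>k=m..n. cis (\<phi> k)) \<le> 2 + 6 / \<delta>"
proof (cases "m = n")
  case True
  then show ?thesis using \<delta> by simp
next
  case False
  then obtain n' where n: "n = Suc n'" "m \<le> n'" using mn by (cases n) auto
  define c where "c k = cot (\<theta> k / 2)" for k
  define g where "g k = Complex (- 1 / 2) (- c k / 2)" for k
  have cot_bound: "\<bar>c k\<bar> \<le> 2 / \<delta>" if "m \<le> k" "k \<le> n'" for k
  proof -
    have x: "\<delta> \<le> \<theta> k" "\<theta> k \<le> 2 * pi - \<delta>" using bnd[of k] that n by auto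
    have "c k \<le> 1 / (\<theta> k / 2)" unfolding c_def using x \<delta> by (intro cot_le_inverse) auto
    also have "\<dots> \<le> 2 / \<delta>" using x \<delta> by (simp add: frac_le)
    finally have "c k \<le> 2 / \<delta>" .
    \<comment> \<open>The reflection of the half angle at pi/2 reduces the lower bound for the
      cotangent to the same one-sided inequality.\<close>
    moreover have "- c k = cot (pi - \<theta> k / 2)" by (simp add: c_def cot_def)
    then have "- c k \<le> 1 / (pi - \<theta> k / 2)" using x \<delta> by (simp only:, intro cot_le_inverse) auto
    moreover have "1 / (pi - \<theta> k / 2) \<le> 1 / (\<delta> / 2)" using x \<delta> by (intro divide_left_mono) auto
    ultimately show ?thesis by simp
  qed
  have diff: "cis (\<phi> k) = g k * (cis (\<phi> (Suc k)) - cis (\<phi> k))" if "m \<le> k" "k \<le> n'" for k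
  proof -
    define x where "x = \<theta> k / 2"
    have "sin x > 0" using bnd[of k] that n \<delta> by (intro sin_gt_zero) (auto simp: x_def)
    then have "Re (g k * (cis (2 * x) - 1)) = (sin x)\<^sup>2 + (cos x)\<^sup>2" "Im (g k * (cis (2 * x) - 1)) = 0"
      by (simp_all add: g_def c_def x_def[symmetric] cot_def cos_double_sin sin_double power2_eq_square)
    then have "g k * (cis (2 * x) - 1) = 1"
      by (simp add: complex_eq_iff)
    moreover have "cis (\<phi> (Suc k)) - cis (\<phi> k) = cis (\<phi> k) * (cis (2 * x) - 1)"
      using \<theta>[of k] that n by (simp add: x_def algebra_simps)
    ultimately show ?thesis by (metis mult.left_commute mult.right_neutral)
  qed
  have tel: "(\<Sum>k=m..j. cis (\<phi> (Suc k)) - cis (\<phi> k)) = cis (\<phi> (Suc j)) - cis (\<phi> m)" if "m \<le> j" for j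
    using that by (rule sum_Suc_diff[OF le_SucI])
  \<comment> \<open>The last term has no forward difference inside the range; it is split off and
    costs 1.\<close>
  have "(\<Sum>k=m..n. cis (\<phi> k)) = (\<Sum>k=m..n'. g k * (cis (\<phi> (Suc k)) - cis (\<phi> k))) + cis (\<phi> n)"
    using n diff by (simp add: sum.nat_ivl_Suc')
  also have "cmod \<dots> \<le> cmod (\<Sum>k=m..n'. g k * (cis (\<phi> (Suc k)) - cis (\<phi> k))) + 1"
    by (rule order_trans[OF norm_triangle_ineq]) simp
  also have "cmod (\<Sum>k=m..n'. g k * (cis (\<phi> (Suc k)) - cis (\<phi> k)))
      \<le> 2 * (cmod (g n') + (\<Sum>k=m..<n'. cmod (g (Suc k) - g k)))"
  proof (rule norm_sum_mult_le_variation[OF n(2)])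
    fix j assume "m \<le> j" "j \<le> n'"
    have "cmod (cis (\<phi> (Suc j)) - cis (\<phi> m)) \<le> 1 + 1"
      by (rule order_trans[OF norm_triangle_ineq4]) simp
    then show "cmod (\<Sum>k=m..j. cis (\<phi> (Suc k)) - cis (\<phi> k)) \<le> 2"
      unfolding tel[OF \<open>m \<le> j\<close>] by simp
  qed
  also have "(\<Sum>k=m..<n'. cmod (g (Suc k) - g k)) = (\<Sum>k=m..<n'. (- c (Suc k) / 2) - (- c k / 2))"
  proof (rule sum.cong[OF refl])
    fix k assume k: "k \<in> {m..<n'}"
    have "g (Suc k) - g k = Complex 0 ((- c (Suc k) / 2) - (- c k / 2))"
      by (simp add: g_def complex_eq_iff)
    then have "cmod (g (Suc k) - g k) = \<bar>(- c (Suc k) / 2) - (- c k / 2)\<bar>"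
      by (simp add: complex_norm)
    moreover have "c (Suc k) \<le> c k"
      unfolding c_def using bnd[of k] bnd[of "Suc k"] mono[of k] k n \<delta>
      by (intro cot_mono_decreasing) auto
    ultimately show "cmod (g (Suc k) - g k) = (- c (Suc k) / 2) - (- c k / 2)" by simp
  qed
  also have "\<dots> = - c n' / 2 - (- c m / 2)"
    by (rule sum_Suc_diff'[OF n(2)])
  also have "cmod (g n') \<le> 1 / 2 + \<bar>c n'\<bar> / 2"
    using cmod_le[of "g n'"] by (simp add: g_def)
  finally have "cmod (\<Sum>k=m..n. cis (\<phi> k)) \<le> 2 * (1 / 2 + \<bar>c n'\<bar> / 2 + (- c n' / 2 - (- c m / 2))) + 1"
    by simp
  \<comment> \<open>The split-off term and twice the real part 1/2 of g make 2; the three remaining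
    cotangents cost at most 2/\<delta> each.\<close>
  also have "\<dots> \<le> 2 + 6 / \<delta>"
  proof -
    have b: "\<bar>c n'\<bar> \<le> 2 / \<delta>" "\<bar>c m\<bar> \<le> 2 / \<delta>"
      using cot_bound[OF n(2) order.refl] cot_bound[OF order.refl n(2)] .
    have "2 * (1 / 2 + \<bar>c n'\<bar> / 2 + (- c n' / 2 - (- c m / 2))) + 1 = 2 + (\<bar>c n'\<bar> - c n' + c m)"
      by (simp add: field_simps)
    also have "\<bar>c n'\<bar> - c n' + c m \<le> 2 / \<delta> + 2 / \<delta> + 2 / \<delta>"
      using b by linarith
    finally show ?thesis by simp
  qed
  finally show ?thesis .
qed

lemma norm_cis_diff_le: "cmod (cis x - cis y) \<le> \<bar>x - y\<bar>"
proof -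
  have "cis x - cis y = cis y * (cis (x - y) - 1)"
    by (simp add: algebra_simps cis_mult)
  then have "cmod (cis x - cis y) = 2 * \<bar>sin ((x - y) / 2)\<bar>"
    using dist_exp_i_1[of "x - y"] by (simp add: norm_mult cis_conv_exp)
  also have "\<dots> \<le> \<bar>x - y\<bar>" using abs_sin_x_le_abs_x[of "(x - y) / 2"] by simp
  finally show ?thesis .
qed

text \<open>By the mean value theorem the increments of 2 \<gamma> are 2 D at interlaced points
  \<xi>, so monotonicity of D alone makes them monotone and reduces the gap condition to the two
  ends. Subtracting 2 pi l brings them into (0, 2 pi) without changing \<open>cis\<close>.\<close>

lemma phase_sum_bound:
  fixes \<gamma> D :: "real \<Rightarrow> real" and l m n :: nat
  assumes deriv: "\<And>x. (\<gamma> has_real_derivative D x) (at x)" and D: "mono D"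
    and mn: "m \<le> n" and \<delta>: "\<delta> > 0"
    and lo: "pi * real l + \<delta> / 2 \<le> D (real m)" and hi: "D (real n) \<le> pi * real (l + 1) - \<delta> / 2"
  shows "cmod (\<Sum>k=m..n. cis (2 * \<gamma> (real k))) \<le> 2 + 6 / \<delta>"
proof -
  have "\<exists>\<xi>. real k < \<xi> \<and> \<xi> < real (Suc k) \<and> \<gamma> (real (Suc k)) - \<gamma> (real k) = D \<xi>" for k
    using MVT2[of "real k" "real (Suc k)" \<gamma> D] deriv by auto
  then obtain \<xi> where \<xi>: "\<And>k. real k < \<xi> k" "\<And>k. \<xi> k < real (Suc k)"
      "\<And>k. \<gamma> (real (Suc k)) - \<gamma> (real k) = D (\<xi> k)"
    by metis
  define \<theta> where "\<theta> k = 2 * D (\<xi> k) - 2 * pi * real l" for k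
  show ?thesis
  proof (rule kusmin_landau[OF mn \<delta>, where \<theta> = \<theta>])
    fix k assume k: "m \<le> k" "k < n"
    have "2 * \<gamma> (real (Suc k)) = 2 * \<gamma> (real k) + \<theta> k + real l * (2 * pi)"
      using \<xi>(3)[of k] by (simp add: \<theta>_def algebra_simps)
    then have "cis (2 * \<gamma> (real (Suc k))) = cis (2 * \<gamma> (real k)) * cis (\<theta> k) * cis (real l * (2 * pi))"
      by (simp only: cis_mult)
    also have "cis (real l * (2 * pi)) = 1" by (simp flip: Complex.DeMoivre)
    finally show "cis (2 * \<gamma> (real (Suc k))) = cis (2 * \<gamma> (real k)) * cis (\<theta> k)" by simp
    have "real m \<le> \<xi> k" "\<xi> k \<le> real n"
      using \<xi>(1)[of k] \<xi>(2)[of k] k by linarith+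
    then have "D (real m) \<le> D (\<xi> k)" "D (\<xi> k) \<le> D (real n)" using D by (auto dest: monoD)
    then show "\<delta> \<le> \<theta> k \<and> \<theta> k \<le> 2 * pi - \<delta>"
      using lo hi by (auto simp: \<theta>_def algebra_simps)
  next
    fix k
    have "\<xi> k \<le> \<xi> (Suc k)" using \<xi>(2)[of k] \<xi>(1)[of "Suc k"] by linarith
    then show "\<theta> k \<le> \<theta> (Suc k)" using D by (auto simp: \<theta>_def dest: monoD)
  qed
qed

text \<open>The increments of cis(h) v split into a twist part, at most V H per step, and a weight
  part, which telescopes to v m - v n because v is nonincreasing. The boundary term v n cancels,
  which leaves V (1 + (n - m) H).\<close>

lemma weighted_sum_bound:
  fixes z :: "nat \<Rightarrow> complex" and h v :: "nat \<Rightarrow> real"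
  assumes mn: "m \<le> n"
    and P: "\<And>j. m \<le> j \<Longrightarrow> j \<le> n \<Longrightarrow> cmod (\<Sum>k=m..j. z k) \<le> P"
    and v: "\<And>k. m \<le> k \<Longrightarrow> k \<le> n \<Longrightarrow> 0 \<le> v k" "\<And>k. m \<le> k \<Longrightarrow> k < n \<Longrightarrow> v (Suc k) \<le> v k"
    and h: "\<And>k. m \<le> k \<Longrightarrow> k < n \<Longrightarrow> \<bar>h (Suc k) - h k\<bar> \<le> H"
    and V: "v m \<le> V"
  shows "cmod (\<Sum>k=m..n. cis (h k) * v k * z k) \<le> P * (V * (1 + real (n - m) * H))"
proof -
  have P0: "0 \<le> P" using P[of m] mn norm_ge_zero order_trans by blast
  have vV: "v k \<le> V" if "m \<le> k" "k \<le> n" for k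
    using that
  proof (induction k rule: dec_induct)
    case (step k)
    then show ?case using v(2)[of k] by simp
  qed (rule V)
  have "cmod (\<Sum>k=m..n. cis (h k) * v k * z k)
      \<le> P * (cmod (cis (h n) * v n) + (\<Sum>k=m..<n. cmod (cis (h (Suc k)) * v (Suc k) - cis (h k) * v k)))"
    by (rule norm_sum_mult_le_variation[OF mn P])
  also have "(\<Sum>k=m..<n. cmod (cis (h (Suc k)) * v (Suc k) - cis (h k) * v k))
      \<le> (\<Sum>k=m..<n. V * H + (- v (Suc k) - (- v k)))"
  proof (rule sum_mono)
    fix k assume k: "k \<in> {m..<n}"
    have "cis (h (Suc k)) * v (Suc k) - cis (h k) * v k
        = v (Suc k) * (cis (h (Suc k)) - cis (h k)) + cis (h k) * of_real (v (Suc k) - v k)"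
      by (simp add: algebra_simps)
    also have "cmod \<dots> \<le> v (Suc k) * cmod (cis (h (Suc k)) - cis (h k)) + (v k - v (Suc k))"
      using v(1)[of "Suc k"] v(2)[of k] k
      by (intro order_trans[OF norm_triangle_ineq]) (simp add: norm_mult del: of_real_diff)
    also have "v (Suc k) * cmod (cis (h (Suc k)) - cis (h k)) \<le> V * H"
      using v(1)[of "Suc k"] vV[of "Suc k"] k order_trans[OF norm_cis_diff_le h[of k]]
      by (intro mult_mono) auto
    finally show "cmod (cis (h (Suc k)) * v (Suc k) - cis (h k) * v k) \<le> V * H + (- v (Suc k) - (- v k))"
      by simp
  qed
  also have "\<dots> = real (n - m) * (V * H) + (v m - v n)"
    using sum_Suc_diff'[OF mn, of "\<lambda>k. - v k"] by (simp only: sum.distrib) simp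
  also have "cmod (cis (h n) * v n) = v n" using v(1)[of n] mn by (simp add: norm_mult)
  also have "P * (v n + (real (n - m) * (V * H) + (v m - v n))) \<le> P * (V * (1 + real (n - m) * H))"
    using V P0 by (intro mult_left_mono) (auto simp: algebra_simps)
  finally show ?thesis using P0 by (simp add: mult_left_mono)
qed

section \<open>Constants uniform over the compact set and the final estimate\<close>

theorem theorem5p2:
  fixes K :: "(real \<times> real \<times> real \<times> real \<times> real \<times> real) set"
  assumes "compact K"
    and "K \<subseteq> {(E, F, \<alpha>, \<beta>, \<sigma>, C). F > 0 \<and> \<alpha> \<ge> 0 \<and> \<beta> > 0 \<and>
                    1/2 \<le> \<sigma> \<and> \<sigma> \<le> 1 \<and> C > 0}"
  shows "\<exists>c L0. \<forall>(E, F, \<alpha>, \<beta>, \<sigma>, C) \<in> K. \<forall>l::nat. l \<ge> L0 \<longrightarrow>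
     (\<forall>h :: nat \<Rightarrow> real.
        (\<forall>n::nat. Xl E F l \<le> real n \<and> real n \<le> Xl E F (l+1) \<longrightarrow>
             \<bar>h (n+1) - h n\<bar> \<le> C * real n powr (- \<beta>)) \<longrightarrow>
        (\<forall>a b :: real. Xl E F l + C * real l powr \<sigma> \<le> a \<and> a < b \<and>
             b \<le> Xl E F (l+1) - C * real l powr \<sigma> \<longrightarrow>
           cmod (\<Sum>n\<in>{n::nat. a < real n \<and> real n \<le> b}.
                 exp (\<i> * complex_of_real (2 * gam E F (real n) + h n))
                 / complex_of_real (deriv (gam E F) (real n) powr \<alpha>))
           \<le> c * real l powr (- \<alpha> - \<sigma> + 1) * (1 + real l powr (1 - 2 * \<beta>))))"
proof (cases "K = {}")
  case True
  then show ?thesis by simp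
next
  case False
  have cont: "continuous_on K (\<lambda>x. fst (snd x))" "continuous_on K (\<lambda>x. snd (snd (snd (snd (snd x)))))"
    by (intro continuous_intros)+
  \<comment> \<open>The minima of F and C over K are attained, hence positive; a bound R on the norm
    controls the parameters from above.\<close>
  obtain x0 where x0: "x0 \<in> K" "\<And>x. x \<in> K \<Longrightarrow> fst (snd x0) \<le> fst (snd x)"
    using continuous_attains_inf[OF assms(1) False cont(1)] by blast
  obtain x1 where x1: "x1 \<in> K" "\<And>x. x \<in> K \<Longrightarrow> snd (snd (snd (snd (snd x1)))) \<le> snd (snd (snd (snd (snd x))))"
    using continuous_attains_inf[OF assms(1) False cont(2)] by blast
  obtain R where R: "\<And>x. x \<in> K \<Longrightarrow> norm x \<le> R"
    using compact_imp_bounded[OF assms(1)] unfolding bounded_iff by blast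
  define F0 C0 where "F0 = fst (snd x0)" and "C0 = snd (snd (snd (snd (snd x1))))"
  have F0: "F0 > 0" and C0: "C0 > 0" using x0(1) x1(1) assms(2) by (auto simp: F0_def C0_def)
  have bounds: "F0 \<le> F" "F \<le> R" "\<bar>E\<bar> \<le> R" "\<beta> \<le> R" "C0 \<le> C" "C \<le> R"
      "\<alpha> \<ge> 0" "\<beta> > 0" "\<sigma> \<le> 1" "F > 0" "C > 0"
    if "(E, F, \<alpha>, \<beta>, \<sigma>, C) \<in> K" for E F \<alpha> \<beta> \<sigma> C
  proof -
    let ?x = "(E, F, \<alpha>, \<beta>, \<sigma>, C)"
    have s: "norm ?x \<le> R" by (rule R[OF that])
    have 1: "norm (F, \<alpha>, \<beta>, \<sigma>, C) \<le> norm ?x" by (rule norm_snd_le)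
    have 2: "norm (\<alpha>, \<beta>, \<sigma>, C) \<le> norm (F, \<alpha>, \<beta>, \<sigma>, C)" by (rule norm_snd_le)
    have 3: "norm (\<beta>, \<sigma>, C) \<le> norm (\<alpha>, \<beta>, \<sigma>, C)" by (rule norm_snd_le)
    have 4: "norm (\<sigma>, C) \<le> norm (\<beta>, \<sigma>, C)" by (rule norm_snd_le)
    have "norm E \<le> norm ?x" "norm F \<le> norm (F, \<alpha>, \<beta>, \<sigma>, C)" "norm \<beta> \<le> norm (\<beta>, \<sigma>, C)" "norm C \<le> norm (\<sigma>, C)"
      by (rule norm_fst_le norm_snd_le)+
    then show "F \<le> R" "\<bar>E\<bar> \<le> R" "\<beta> \<le> R" "C \<le> R" using s 1 2 3 4 by auto
    show "F0 \<le> F" "C0 \<le> C" using x0(2)[OF that] x1(2)[OF that] by (simp_all add: F0_def C0_def)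
    show "\<alpha> \<ge> 0" "\<beta> > 0" "\<sigma> \<le> 1" "F > 0" "C > 0" using that assms(2) by auto
  qed
  obtain c L0 where c: "0 < c" "c \<le> 1" and
    X: "\<And>E F l. F0 \<le> F \<Longrightarrow> F \<le> R \<Longrightarrow> \<bar>E\<bar> \<le> R \<Longrightarrow> L0 \<le> l \<Longrightarrow> deriv (gam E F) (Xl E F l) = pi * real l"
    "\<And>E F l. F0 \<le> F \<Longrightarrow> F \<le> R \<Longrightarrow> \<bar>E\<bar> \<le> R \<Longrightarrow> L0 \<le> l \<Longrightarrow> c * (real l)\<^sup>2 \<le> Xl E F l"
    "\<And>E F l x y. F0 \<le> F \<Longrightarrow> F \<le> R \<Longrightarrow> \<bar>E\<bar> \<le> R \<Longrightarrow> L0 \<le> l \<Longrightarrow>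
       Xl E F l \<le> x \<Longrightarrow> x \<le> y \<Longrightarrow> y \<le> Xl E F (l + 1) \<Longrightarrow>
       c / real l * (y - x) \<le> deriv (gam E F) y - deriv (gam E F) x"
    by (rule Xl_regularity[OF F0]) (rule that)
  \<comment> \<open>\<open>P\<close> absorbs 2 + 6/\<delta> into a multiple of l^(1-\<sigma>).
    \<open>Q\<close> combines the bound pi l / c on the number of steps with the factor R c^(-R)
    from the increments of h.\<close>
  define P Q where "P = 2 + 3 / (c * C0)" and "Q = 1 + pi / c * R * c powr (- R)"
  have PQ: "P \<ge> 0" using c C0 by (simp add: P_def)
  have main: "cmod (\<Sum>n\<in>{n::nat. a < real n \<and> real n \<le> b}.
                 exp (\<i> * complex_of_real (2 * gam E F (real n) + h n))
                 / complex_of_real (deriv (gam E F) (real n) powr \<alpha>))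
           \<le> P * Q * real l powr (- \<alpha> - \<sigma> + 1) * (1 + real l powr (1 - 2 * \<beta>))"
    if K: "(E, F, \<alpha>, \<beta>, \<sigma>, C) \<in> K" and l: "max 1 L0 \<le> l"
      and h: "\<forall>n::nat. Xl E F l \<le> real n \<and> real n \<le> Xl E F (l+1) \<longrightarrow>
             \<bar>h (n+1) - h n\<bar> \<le> C * real n powr (- \<beta>)"
      and a: "Xl E F l + C * real l powr \<sigma> \<le> a" and ab: "a < b"
      and b: "b \<le> Xl E F (l+1) - C * real l powr \<sigma>"
    for E F \<alpha> \<beta> \<sigma> C and l :: nat and h :: "nat \<Rightarrow> real" and a b
  proof -
    note k = bounds[OF K]
    note X = X[OF k(1,2,3)]
    have l1: "l \<ge> 1" and lL: "L0 \<le> l" using l by auto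
    define D where "D = deriv (gam E F)"
    have dD: "(gam E F has_real_derivative D x) (at x)" for x
      using gam_has_derivative[OF k(10), of E x] by (simp add: D_def deriv_gam k(10))
    have D: "mono D" unfolding D_def by (rule strict_mono_mono[OF deriv_gam_strict_mono[OF k(10)]])
    \<comment> \<open>The phase derivative grows at rate at least c/l over a distance C l^\<sigma>,
      hence by at least \<delta>/2; the factor 2 accounts for the phase 2 \<gamma>, and the minimum
      \<open>C0\<close> replaces C for uniformity.\<close>
    define \<delta> where "\<delta> = 2 * c * C0 * real l powr (\<sigma> - 1)"
    have \<delta>: "\<delta> > 0" using c C0 l1 by (simp add: \<delta>_def)
    have Cl: "0 \<le> C * real l powr \<sigma>" using k by simp
    have \<delta>_le: "\<delta> / 2 \<le> c / l * (C * real l powr \<sigma>)"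
    proof -
      have "\<delta> / 2 = c * C0 * (real l powr \<sigma> / l)" using l1 by (simp add: \<delta>_def powr_diff)
      also have "\<dots> \<le> c * C * (real l powr \<sigma> / l)" using c k by (intro mult_right_mono mult_left_mono) auto
      finally show ?thesis by simp
    qed
    have X0: "c * (real l)\<^sup>2 \<le> Xl E F l" by (rule X(2)[OF lL])
    have cl: "0 < c * (real l)\<^sup>2" using c l1 by simp
    have XD: "D (Xl E F l) = pi * real l" "D (Xl E F (l + 1)) = pi * real (l + 1)"
      unfolding D_def using lL by (intro X(1); simp)+
    have a_lo: "pi * real l + \<delta> / 2 \<le> D a"
    proof -
      have "c / l * (C * real l powr \<sigma>) \<le> c / l * (a - Xl E F l)"
        using a c by (intro mult_left_mono) auto
      also have "\<dots> \<le> D a - D (Xl E F l)"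
        unfolding D_def using a b ab Cl by (intro X(3)[OF lL]) auto
      finally show ?thesis using \<delta>_le XD by linarith
    qed
    have b_hi: "D b \<le> pi * real (l + 1) - \<delta> / 2"
    proof -
      have "c / l * (C * real l powr \<sigma>) \<le> c / l * (Xl E F (l + 1) - b)"
        using b c by (intro mult_left_mono) auto
      also have "\<dots> \<le> D (Xl E F (l + 1)) - D b"
        unfolding D_def using a b ab Cl by (intro X(3)[OF lL]) auto
      finally show ?thesis using \<delta>_le XD by linarith
    qed
    \<comment> \<open>The same growth rate read backwards: the phase derivative gains at most pi
      between a and b, so the interval has length O(l).\<close>
    have ba: "b - a \<le> pi * l / c"
    proof -
      have "c / l * (b - a) \<le> D b - D a"
        unfolding D_def using a b ab Cl by (intro X(3)[OF lL]) auto
      also have "\<dots> \<le> pi" using a_lo b_hi \<delta> by (simp add: algebra_simps)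
      finally show ?thesis using c l1 by (simp add: field_simps)
    qed
    \<comment> \<open>The \<open>+ 1\<close> reflects the strict inequality at a; the truncation by
      \<open>nat\<close> is harmless since a > 0.\<close>
    define m n where "m = nat \<lfloor>a\<rfloor> + 1" and "n = nat \<lfloor>b\<rfloor>"
    have a0: "a > 0" using a Cl X0 cl by linarith
    have set: "{n::nat. a < real n \<and> real n \<le> b} = {m..n}"
      using a0 ab by (auto simp: m_def n_def le_nat_floor nat_le_iff) linarith+
    have rhs0: "0 \<le> P * Q * real l powr (- \<alpha> - \<sigma> + 1) * (1 + real l powr (1 - 2 * \<beta>))"
    proof -
      have "Q \<ge> 0" using c k by (auto simp: Q_def intro!: add_nonneg_nonneg mult_nonneg_nonneg)
      then show ?thesis using PQ by (intro mult_nonneg_nonneg) (auto intro: add_nonneg_nonneg)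
    qed
    show ?thesis
    proof (cases "m \<le> n")
      case False
      then show ?thesis using rhs0 by (simp add: set)
    next
      case True
      have "m \<in> {n. a < real n \<and> real n \<le> b}" "n \<in> {n. a < real n \<and> real n \<le> b}"
        unfolding set using True by auto
      then have m: "a < real m" and n: "real n \<le> b" by auto
      have in_ab: "a < real k" "real k \<le> b" if "m \<le> k" "k \<le> n" for k
        using that m n by linarith+
      define v where "v k = D (real k) powr (- \<alpha>)" for k :: nat
      define V where "V = real l powr (- \<alpha>)"
      \<comment> \<open>The factor pi is weakened to 1, so that \<open>V\<close> is exactly
        l^(-\<alpha>) and no constant depends on \<alpha>.\<close>
      have Dl: "real l \<le> D (real k)" "0 < D (real k)" if "m \<le> k" for k
      proof -
        have "D a \<le> D (real k)" by (rule monoD[OF D]) (use that m in linarith)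
        moreover have "1 * real l \<le> pi * real l" using pi_gt3 by (intro mult_right_mono) auto
        ultimately show "real l \<le> D (real k)" using a_lo \<delta> by linarith
        then show "0 < D (real k)" using l1 by linarith
      qed
      \<comment> \<open>Every integer j in the range is at least c l^2, which gives j^(-\<beta>)
        \<le> c^(-\<beta>) l^(-2\<beta>); then c \<le> 1 and \<beta> \<le> R replace c^(-\<beta>) by
        c^(-R).\<close>
      define H where "H = R * c powr (- R) * real l powr (- 2 * \<beta>)"
      have sum_le: "cmod (\<Sum>k=m..n. cis (h k) * v k * cis (2 * gam E F (real k)))
          \<le> (2 + 6 / \<delta>) * (V * (1 + real (n - m) * H))"
      proof (rule weighted_sum_bound[OF True])
        fix j assume j: "m \<le> j" "j \<le> n"
        have "D a \<le> D (real m)" "D (real j) \<le> D b"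
          using m in_ab[OF j] by (auto intro: monoD[OF D])
        then show "cmod (\<Sum>k=m..j. cis (2 * gam E F (real k))) \<le> 2 + 6 / \<delta>"
          using a_lo b_hi by (intro phase_sum_bound[OF dD D j(1) \<delta>, of l]) linarith+
      next
        fix j assume j: "m \<le> j" "j < n"
        have "D (real j) \<le> D (real (Suc j))" by (rule monoD[OF D]) simp
        then show "v (Suc j) \<le> v j" unfolding v_def using Dl[of j] j k
          by (intro powr_mono2') auto
        have Xj: "c * (real l)\<^sup>2 \<le> real j" using in_ab[of j] j X0 a Cl by linarith
        have "\<bar>h (Suc j) - h j\<bar> \<le> C * real j powr (- \<beta>)"
          using h[rule_format, of j] in_ab[of j] j a b Cl by simp
        also have "\<dots> \<le> R * (c * (real l)\<^sup>2) powr (- \<beta>)"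
          using k Xj cl by (intro mult_mono powr_mono2') auto
        also have "(c * (real l)\<^sup>2) powr (- \<beta>) = c powr (- \<beta>) * real l powr (- 2 * \<beta>)"
          using l1 c by (simp add: powr_mult powr_powr flip: powr_numeral)
        also have "R * (c powr (- \<beta>) * real l powr (- 2 * \<beta>)) \<le> R * (c powr (- R) * real l powr (- 2 * \<beta>))"
          using k c by (intro mult_left_mono mult_right_mono powr_mono') auto
        finally show "\<bar>h (Suc j) - h j\<bar> \<le> H" by (simp add: H_def mult_ac)
      next
        show "v m \<le> V" unfolding v_def V_def using Dl[of m] l1 k by (intro powr_mono2') auto
      qed (auto simp: v_def)
      have P_le: "2 + 6 / \<delta> \<le> P * real l powr (1 - \<sigma>)"
      proof -
        have "6 / \<delta> = 3 / (c * C0) * real l powr (1 - \<sigma>)"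
          using powr_minus_divide[of "real l" "\<sigma> - 1"] by (simp add: \<delta>_def)
        moreover have "1 \<le> real l powr (1 - \<sigma>)" using l1 k by (intro ge_one_powr_ge_zero) auto
        ultimately show ?thesis by (simp add: P_def algebra_simps)
      qed
      have Q_le: "1 + real (n - m) * H \<le> Q * (1 + real l powr (1 - 2 * \<beta>))"
      proof -
        have "real (n - m) \<le> pi * l / c" using ba m n True by (simp add: of_nat_diff)
        then have "real (n - m) * H \<le> pi * l / c * H"
          using k by (intro mult_right_mono) (auto simp: H_def)
        also have "\<dots> = (pi / c * R * c powr (- R)) * (real l * real l powr (- 2 * \<beta>))"
          by (simp add: H_def)
        also have "real l * real l powr (- 2 * \<beta>) = real l powr (1 - 2 * \<beta>)"
          using l1 powr_add[of "real l" 1 "- 2 * \<beta>"] by simp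
        finally have "real (n - m) * H \<le> (pi / c * R * c powr (- R)) * real l powr (1 - 2 * \<beta>)" .
        moreover have "0 \<le> pi / c * R * c powr (- R)" using c k by auto
        moreover have "0 \<le> real l powr (1 - 2 * \<beta>)" by simp
        moreover have "Q * (1 + t) = 1 + pi / c * R * c powr (- R) + t + pi / c * R * c powr (- R) * t" for t
          unfolding Q_def by algebra
        ultimately show ?thesis by (simp only:)
      qed
      have "0 \<le> H" using k by (simp add: H_def)
      then have main: "cmod (\<Sum>k=m..n. cis (h k) * v k * cis (2 * gam E F (real k)))
          \<le> P * real l powr (1 - \<sigma>) * (V * (Q * (1 + real l powr (1 - 2 * \<beta>))))"
        using PQ by (intro order_trans[OF sum_le mult_mono[OF P_le mult_left_mono[OF Q_le]]]) (auto simp: V_def)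
      have "real l powr (1 - \<sigma>) * V = real l powr (- \<alpha> - \<sigma> + 1)"
        by (simp add: V_def algebra_simps flip: powr_add)
      then have "P * real l powr (1 - \<sigma>) * (V * (Q * (1 + real l powr (1 - 2 * \<beta>))))
          = P * Q * real l powr (- \<alpha> - \<sigma> + 1) * (1 + real l powr (1 - 2 * \<beta>))"
        by (metis mult.assoc mult.commute)
      moreover have "(\<Sum>k=m..n. cis (h k) * v k * cis (2 * gam E F (real k)))
          = (\<Sum>n\<in>{m..n}. exp (\<i> * complex_of_real (2 * gam E F (real n) + h n))
                 / complex_of_real (deriv (gam E F) (real n) powr \<alpha>))"
      proof -
        have "exp (\<i> * complex_of_real (x + y)) = cis y * cis x" for x y
          by (simp only: cis_conv_exp[symmetric] cis_mult add.commute)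
        then show ?thesis unfolding v_def D_def powr_minus
          by (simp only: divide_inverse of_real_inverse mult_ac)
      qed
      ultimately show ?thesis using main unfolding set by (simp only:)
    qed
  qed
  show ?thesis
    by (rule exI[of _ "P * Q"], rule exI[of _ "max 1 L0"]) (use main in blast)
qed

end
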